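(* Let $K\in\mathbb{R}^{n\times n}$ be symmetric positive semidefinite, let $1\le k<n$ with $\lambda_k(K)>0$, let $\Omega\in\mathbb{R}^{n\times\ell}$, and let $$\widehat K:=(K\Omega)(\Omega^\top K\Omega)^\dagger(K\Omega)^\top$$ be the Nyström approximation to $K$. Define $$\begin{bmatrix}\Omega_k\\ \Omega_{n-k}\end{bmatrix}:=\begin{bmatrix}V_k^\top\Omega\\ V_\perp^\top\Omega\end{bmatrix}$$ and assume that $\operatorname{rank}(\Omega_k)=k$. Then the eigenvalues of $\widehat K$ satisfy $$\lambda_i(K)\ \ge\ \lambda_i(\widehat K)\ \ge\ \frac{\lambda_i(K)}{1+\lambda_i(\Lambda_k^{-1})\,\|\Lambda_\perp^{1/2}\Omega_{n-k}\Omega_k^\dagger\|_2^2},\qquad 1\le i\le k.$$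
   Context: $\dagger$ denotes the Moore--Penrose pseudoinverse and $\|\cdot\|_2$ the spectral norm. For a real symmetric matrix $A\in\mathbb{R}^{m\times m}$, $\lambda_1(A)\ge\cdots\ge\lambda_m(A)$ denote its eigenvalues in non-increasing order. The eigendecomposition of $K$ is partitioned as $$K=\begin{bmatrix}V_k & V_\perp\end{bmatrix}\begin{bmatrix}\Lambda_k&0\\0&\Lambda_\perp\end{bmatrix}\begin{bmatrix}V_k^\top\\ V_\perp^\top\end{bmatrix},$$ where $\begin{bmatrix}V_k & V_\perp\end{bmatrix}\in\mathbb{R}^{n\times n}$ is orthogonal, $V_k\in\mathbb{R}^{n\times k}$, $V_\perp\in\mathbb{R}^{n\times(n-k)}$, $\Lambda_k=\operatorname{diag}(\lambda_1(K),\dots,\lambda_k(K))$ and $\Lambda_\perp=\operatorname{diag}(\lambda_{k+1}(K),\dots,\lambda_n(K))$.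
   Formalization: In the lower bound, λ_i(Λ_k^{-1}) is read as 1/λ_i(K), i.e. the eigenvalues of Λ_k^{-1} are numbered in non-decreasing order; with the stated non-increasing convention the bound is false, e.g. K=diag(100,1,1/2), Ω with rows (1,0),(0,1),(0,√2), i=k=2. *)

theory Defs
  imports
    "Jordan_Normal_Form.Char_Poly"
    "Jordan_Normal_Form.Gauss_Jordan_Elimination"
    "Jordan_Normal_Form.DL_Rank"
    Complex_Main
begin

text \<open>Real eigenvalues with algebraic multiplicity. For a symmetric
  \<open>m \<times> m\<close> matrix the characteristic polynomial splits over the reals, so the list has
  length \<open>m\<close>. The index of \<open>eig\<close> starts at 1, and \<open>eig A i\<close> is meaningful for
  symmetric \<open>A\<close> and \<open>1 \<le> i \<le> m\<close> only.\<close>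

definition eigs_desc :: "real mat \<Rightarrow> real list" where
  "eigs_desc A = rev (sorted_list_of_multiset (proots (char_poly A)))"

definition eig :: "real mat \<Rightarrow> nat \<Rightarrow> real" where
  "eig A i = eigs_desc A ! (i - 1)"

definition sym_psd :: "real mat \<Rightarrow> bool" where
  "sym_psd A \<longleftrightarrow> A \<in> carrier_mat (dim_row A) (dim_row A) \<and> A\<^sup>T = A \<and>
     (\<forall>x \<in> carrier_vec (dim_row A). x \<bullet> (A *\<^sub>v x) \<ge> 0)"

text \<open>The Moore--Penrose pseudoinverse, as the unique solution of the four Penrose equations.\<close>

definition is_pinv :: "real mat \<Rightarrow> real mat \<Rightarrow> bool" where
  "is_pinv A X \<longleftrightarrow> X \<in> carrier_mat (dim_col A) (dim_row A) \<and>
     A * X * A = A \<and> X * A * X = X \<and> (A * X)\<^sup>T = A * X \<and> (X * A)\<^sup>T = X * A"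

definition pinv :: "real mat \<Rightarrow> real mat" where
  "pinv A = (THE X. is_pinv A X)"

definition vec_norm2 :: "real vec \<Rightarrow> real" where
  "vec_norm2 x = sqrt (x \<bullet> x)"

definition spectral_norm :: "real mat \<Rightarrow> real" where
  "spectral_norm A = (SUP x \<in> {x \<in> carrier_vec (dim_col A). vec_norm2 x \<le> 1}. vec_norm2 (A *\<^sub>v x))"

definition append_cols :: "'a :: zero mat \<Rightarrow> 'a mat \<Rightarrow> 'a mat" where
  "append_cols A B = four_block_mat A B (0\<^sub>m 0 (dim_col A)) (0\<^sub>m 0 (dim_col B))"

text \<open>The library's \<open>orthogonal_mat\<close> only asks for pairwise orthogonal nonzero columns;
  here the columns are orthonormal.\<close>

definition orthonormal_mat :: "nat \<Rightarrow> real mat \<Rightarrow> bool" where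
  "orthonormal_mat n V \<longleftrightarrow> V \<in> carrier_mat n n \<and> V\<^sup>T * V = 1\<^sub>m n \<and> V * V\<^sup>T = 1\<^sub>m n"

definition Lam_top :: "nat \<Rightarrow> real mat \<Rightarrow> real mat" where
  "Lam_top k K = mat_diag k (\<lambda>j. eig K (j + 1))"

definition Lam_perp :: "nat \<Rightarrow> nat \<Rightarrow> real mat \<Rightarrow> real mat" where
  "Lam_perp n k K = mat_diag (n - k) (\<lambda>j. eig K (k + j + 1))"

text \<open>The square root of a nonnegative diagonal matrix: entrywise on the diagonal, and
  \<open>sqrt 0 = 0\<close> takes care of the rest.\<close>

definition diag_sqrt :: "real mat \<Rightarrow> real mat" where
  "diag_sqrt D = map_mat sqrt D"

text \<open>A partitioned eigendecomposition of \<open>K\<close>, with \<open>Vk\<close> and \<open>Vp\<close> spanning the leading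
  \<open>k\<close> and trailing \<open>n - k\<close> eigendirections.\<close>

definition eigendecomp :: "nat \<Rightarrow> nat \<Rightarrow> real mat \<Rightarrow> real mat \<Rightarrow> real mat \<Rightarrow> bool" where
  "eigendecomp n k K Vk Vp \<longleftrightarrow>
     Vk \<in> carrier_mat n k \<and> Vp \<in> carrier_mat n (n - k) \<and>
     orthonormal_mat n (append_cols Vk Vp) \<and>
     K = append_cols Vk Vp
         * four_block_mat (Lam_top k K) (0\<^sub>m k (n - k)) (0\<^sub>m (n - k) k) (Lam_perp n k K)
         * (append_cols Vk Vp)\<^sup>T"

definition nystrom :: "real mat \<Rightarrow> real mat \<Rightarrow> real mat" where
  "nystrom K Om = (K * Om) * pinv (Om\<^sup>T * K * Om) * (K * Om)\<^sup>T"

text \<open>The \<open>i\<close>-th eigenvalue of the inverse of an invertible symmetric \<open>k \<times> k\<close> matrix \<open>A\<close>,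
  numbered so that it belongs to the same eigenvector as \<open>eig A i\<close>. Inversion reverses the order
  of positive eigenvalues, hence for positive definite \<open>A\<close> the index runs through
  \<open>eigs_desc\<close> of the inverse backwards and the value is \<open>1 / eig A i\<close>. (With the
  non-increasing numbering of \<open>eig\<close> for the inverse, the lower eigenvalue bound in terms of
  it would fail, e.g. for \<open>K = diag(100, 1, 1/2)\<close> and the \<open>3 \<times> 2\<close> test matrix with rows
  \<open>(1, 0)\<close>, \<open>(0, 1)\<close>, \<open>(0, sqrt 2)\<close> at \<open>i = k = 2\<close>.)\<close>

definition inv_eig :: "real mat \<Rightarrow> nat \<Rightarrow> real" where
  "inv_eig A i = eig (the (mat_inverse A)) (dim_row A + 1 - i)"

end

theory Submission
  imports Defs "Jordan_Normal_Form.Spectral_Radius"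
begin

text \<open>
  Write \<open>K\<^sub>N\<close> for the Nystrom approximation, \<open>\<lambda>\<^sub>i\<close> for the eigenvalues of \<open>K\<close> and \<open>s\<close> for the
  squared spectral norm in the denominator. In the numbering fixed for the inverse, the factor of
  \<open>s\<close> is \<open>1 / \<lambda>\<^sub>i\<close> (\<open>inv_eig_mat_diag\<close>), so the lower bound reads \<open>\<lambda>\<^sub>i\<^sup>2 / (\<lambda>\<^sub>i + s)\<close>.

  Both bounds rest on one fact (\<open>nystrom_projection\<close>): \<open>K\<^sub>N x = K u\<close>, where \<open>u\<close> is the
  projection of \<open>x\<close> onto the range of \<open>\<Omega>\<close> that is orthogonal with respect to the semi-inner
  product of \<open>K\<close>. A projection does not lengthen vectors, so
  \<open>x \<bullet> K\<^sub>N x \<le> x \<bullet> K x\<close> (\<open>nystrom_le\<close>), and the upper bound is monotonicity of eigenvalues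
  (\<open>eig_mono\<close>).

  For the lower bound it suffices to find an \<open>i\<close>-dimensional space on which the Rayleigh quotient
  of \<open>K\<^sub>N\<close> is large (\<open>courant_fischer_lower\<close>). For \<open>v\<close> in the range of \<open>\<Omega>\<close> the quotient at
  \<open>z = K v\<close> is at least \<open>(z \<bullet> z) / (v \<bullet> K v)\<close> (\<open>nystrom_rayleigh_lower\<close>). Take
  \<open>v = \<Omega> \<Omega>\<^sub>k\<^sup>\<dagger> a\<close> with \<open>a\<close> supported on the first \<open>i\<close> coordinates. By the rank condition
  \<open>\<Omega>\<^sub>k \<Omega>\<^sub>k\<^sup>\<dagger> = 1\<close>, so in the eigenbasis \<open>v\<close> has leading part \<open>a\<close>. The trailing part adds at
  most \<open>s (a \<bullet> a)\<close> to \<open>v \<bullet> K v\<close>, and the quotient is at least a weighted mean of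
  \<open>\<lambda>\<^sub>j\<^sup>2 / (\<lambda>\<^sub>j + s)\<close> over \<open>j \<le> i\<close>, hence at least \<open>\<lambda>\<^sub>i\<^sup>2 / (\<lambda>\<^sub>i + s)\<close>
  (\<open>nystrom_eig_lower\<close>).

  The linear algebra behind this is developed from the existence of complex eigenvalues: the
  spectral theorem for real symmetric matrices (\<open>symmetric_eigendecomposition\<close>), and from it the
  variational bounds and the existence of the pseudoinverse (\<open>is_pinv_exists\<close>).
\<close>

section \<open>Real vectors and matrices\<close>

lemma scalar_prod_self_sum: "(x :: real vec) \<bullet> x = (\<Sum>i<dim_vec x. (x $ i)\<^sup>2)"
  by (simp add: scalar_prod_def power2_eq_square atLeast0LessThan)

lemma scalar_prod_self_nonneg: "0 \<le> (x :: real vec) \<bullet> x"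
  by (simp add: scalar_prod_self_sum sum_nonneg)

lemma scalar_prod_self_eq_0_iff:
  assumes "(x :: real vec) \<in> carrier_vec n"
  shows "x \<bullet> x = 0 \<longleftrightarrow> x = 0\<^sub>v n"
proof
  assume "x \<bullet> x = 0"
  then have "\<forall>i\<in>{..<n}. (x $ i)\<^sup>2 = 0"
    using assms by (subst (asm) scalar_prod_self_sum, subst (asm) sum_nonneg_eq_0_iff) auto
  then show "x = 0\<^sub>v n" using assms by (intro eq_vecI) auto
qed (use assms in auto)

lemma scalar_prod_self_pos:
  assumes "(x :: real vec) \<in> carrier_vec n" "x \<noteq> 0\<^sub>v n"
  shows "0 < x \<bullet> x"
  using scalar_prod_self_nonneg[of x] scalar_prod_self_eq_0_iff[OF assms(1)] assms(2)
  by linarith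

lemma mat_eqI_mult_vec:
  fixes A B :: "real mat"
  assumes A: "A \<in> carrier_mat nr nc" and B: "B \<in> carrier_mat nr nc"
    and eq: "\<And>x. x \<in> carrier_vec nc \<Longrightarrow> A *\<^sub>v x = B *\<^sub>v x"
  shows "A = B"
proof (rule eq_matI)
  fix i j assume "i < dim_row B" "j < dim_col B"
  then have ij: "i < nr" "j < nc" using B by auto
  have "(A *\<^sub>v unit_vec nc j) $ i = (B *\<^sub>v unit_vec nc j) $ i" by (simp add: eq)
  then show "A $$ (i,j) = B $$ (i,j)" using ij A B by (simp add: row_def)
qed (use A B in auto)

text \<open>Side conditions on dimensions rather than on carriers: the simplifier can evaluate them for
  compound factors, whereas an intermediate dimension of a product is not determined by a carrier.\<close>

lemma mat_mult_assoc_dim: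
  "dim_col A = dim_row B \<Longrightarrow> dim_col B = dim_row C \<Longrightarrow> (A * B) * C = A * (B * (C :: real mat))"
  by (rule assoc_mult_mat[of _ "dim_row A" "dim_row B" _ "dim_row C" _ "dim_col C"]) auto

lemma mat_vec_mult_assoc_dim:
  "dim_col A = dim_row B \<Longrightarrow> dim_col B = dim_vec v \<Longrightarrow> (A * B) *\<^sub>v v = A *\<^sub>v (B *\<^sub>v (v :: real vec))"
  by (rule assoc_mult_mat_vec[of _ "dim_row A" "dim_row B" _ "dim_vec v"]) auto

lemma transpose_mult_dim:
  "dim_col A = dim_row B \<Longrightarrow> (A * B)\<^sup>T = B\<^sup>T * (A :: real mat)\<^sup>T"
  by (rule transpose_mult[of _ "dim_row A" "dim_row B" _ "dim_col B"]) auto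

lemma symmetric_congruence:
  fixes A :: "'a :: comm_semiring_0 mat"
  assumes A: "A \<in> carrier_mat n n" and P: "P \<in> carrier_mat n m" and sym: "A\<^sup>T = A"
  shows "(P\<^sup>T * A * P)\<^sup>T = P\<^sup>T * A * P"
proof -
  have "(P\<^sup>T * A * P)\<^sup>T = P\<^sup>T * (P\<^sup>T * A)\<^sup>T"
    using A P by (simp add: transpose_mult[of _ m n _ m] del: assoc_mult_mat)
  also have "(P\<^sup>T * A)\<^sup>T = A * P"
    using A P sym by (simp add: transpose_mult[of _ m n _ n])
  finally show ?thesis using A P by (simp add: assoc_mult_mat[of _ m n _ n _ m])
qed

section \<open>The spectral theorem for real symmetric matrices\<close>

text \<open>Over the complex numbers an eigenvector \<open>x + \<i> y\<close> exists. Comparing \<open>y \<bullet> A x\<close>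
  with \<open>x \<bullet> A y\<close> shows that the imaginary part of the eigenvalue, multiplied by
  \<open>x \<bullet> x + y \<bullet> y\<close>, vanishes. So the eigenvalue is real, and one of \<open>x\<close>, \<open>y\<close>
  is a real eigenvector.\<close>

lemma symmetric_real_eigenvector:
  fixes A :: "real mat"
  assumes A: "A \<in> carrier_mat n n" and sym: "A\<^sup>T = A" and n: "0 < n"
  obtains e v where "v \<in> carrier_vec n" "v \<bullet> v = 1" "A *\<^sub>v v = e \<cdot>\<^sub>v v"
proof -
  define C where "C = map_mat complex_of_real A"
  have C: "C \<in> carrier_mat n n" using A by (simp add: C_def)
  obtain \<mu> where "eigenvalue C \<mu>"
    using spectrum_non_empty[OF C n] by (auto simp: spectrum_def)
  then obtain z where z: "z \<in> carrier_vec n" "z \<noteq> 0\<^sub>v n" "C *\<^sub>v z = \<mu> \<cdot>\<^sub>v z"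
    using C by (auto simp: eigenvalue_def eigenvector_def)
  define x y where "x = map_vec Re z" and "y = map_vec Im z"
  have x: "x \<in> carrier_vec n" and y: "y \<in> carrier_vec n"
    using z(1) by (auto simp: x_def y_def)
  have xy_index: "x $ i = Re (z $ i)" "y $ i = Im (z $ i)" if "i < n" for i
    using that z(1) by (auto simp: x_def y_def)
  have Cz: "(\<Sum>j<n. complex_of_real (A $$ (i,j)) * z $ j) = \<mu> * z $ i" if "i < n" for i
  proof -
    have "(C *\<^sub>v z) $ i = (\<mu> \<cdot>\<^sub>v z) $ i" using z(3) by simp
    then show ?thesis using that A z(1) by (auto simp: C_def scalar_prod_def atLeast0LessThan)
  qed
  have Ax: "A *\<^sub>v x = Re \<mu> \<cdot>\<^sub>v x - Im \<mu> \<cdot>\<^sub>v y"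
  proof (rule eq_vecI)
    fix i assume "i < dim_vec (Re \<mu> \<cdot>\<^sub>v x - Im \<mu> \<cdot>\<^sub>v y)"
    then have i: "i < n" using y by simp
    have "(A *\<^sub>v x) $ i = Re (\<Sum>j<n. complex_of_real (A $$ (i,j)) * z $ j)"
      using i A x by (simp add: scalar_prod_def atLeast0LessThan xy_index)
    then show "(A *\<^sub>v x) $ i = (Re \<mu> \<cdot>\<^sub>v x - Im \<mu> \<cdot>\<^sub>v y) $ i"
      using i x y by (simp add: Cz xy_index)
  qed (use A y in auto)
  have Ay: "A *\<^sub>v y = Im \<mu> \<cdot>\<^sub>v x + Re \<mu> \<cdot>\<^sub>v y"
  proof (rule eq_vecI)
    fix i assume "i < dim_vec (Im \<mu> \<cdot>\<^sub>v x + Re \<mu> \<cdot>\<^sub>v y)"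
    then have i: "i < n" using y by simp
    have "(A *\<^sub>v y) $ i = Im (\<Sum>j<n. complex_of_real (A $$ (i,j)) * z $ j)"
      using i A y by (simp add: scalar_prod_def atLeast0LessThan xy_index)
    then show "(A *\<^sub>v y) $ i = (Im \<mu> \<cdot>\<^sub>v x + Re \<mu> \<cdot>\<^sub>v y) $ i"
      using i x y by (simp add: Cz xy_index)
  qed (use A y in auto)
  have "y \<bullet> (A *\<^sub>v x) = x \<bullet> (A *\<^sub>v y)"
    using transpose_vec_mult_scalar[OF A x y] sym comm_scalar_prod[of "A *\<^sub>v y" n x] A x y by auto
  then have "Im \<mu> * (x \<bullet> x + y \<bullet> y) = 0"
    unfolding Ax Ay using x y comm_scalar_prod[OF x y]
    by (simp add: scalar_prod_add_distrib[of _ n] scalar_prod_minus_distrib[of _ n] algebra_simps)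
  moreover have nz: "x \<noteq> 0\<^sub>v n \<or> y \<noteq> 0\<^sub>v n"
  proof (rule ccontr)
    assume "\<not> ?thesis"
    then have "z $ i = 0" if "i < n" for i
      using xy_index[OF that] that by (simp add: complex_eq_iff)
    then have "z = 0\<^sub>v n" using z(1) by (intro eq_vecI) auto
    with z(2) show False ..
  qed
  then have "x \<bullet> x + y \<bullet> y > 0"
    using scalar_prod_self_pos[OF x] scalar_prod_self_pos[OF y]
      scalar_prod_self_nonneg[of x] scalar_prod_self_nonneg[of y] by fastforce
  ultimately have im: "Im \<mu> = 0" by simp
  have "A *\<^sub>v x = Re \<mu> \<cdot>\<^sub>v x" "A *\<^sub>v y = Re \<mu> \<cdot>\<^sub>v y"
    unfolding Ax Ay im using x y by (auto intro!: eq_vecI)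
  then obtain w where w: "w \<in> carrier_vec n" "w \<noteq> 0\<^sub>v n" "A *\<^sub>v w = Re \<mu> \<cdot>\<^sub>v w"
    using nz x y by blast
  define v where "v = (1 / sqrt (w \<bullet> w)) \<cdot>\<^sub>v w"
  show ?thesis
  proof (rule that)
    show "v \<in> carrier_vec n" using w by (simp add: v_def)
    show "v \<bullet> v = 1"
      using w scalar_prod_self_pos[OF w(1,2)] by (simp add: v_def)
    show "A *\<^sub>v v = Re \<mu> \<cdot>\<^sub>v v"
      using w A by (simp add: v_def mult_mat_vec[OF A] smult_smult_assoc mult.commute)
  qed
qed

text \<open>The Householder reflection that exchanges the first unit vector with \<open>v\<close>. Its
  columns are an explicit orthonormal basis that starts with \<open>v\<close>.\<close>

lemma orthonormal_mat_with_first_column: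
  fixes v :: "real vec"
  assumes v: "v \<in> carrier_vec n" "v \<bullet> v = 1" and n: "0 < n"
  obtains H where "orthonormal_mat n H" "col H 0 = v"
proof -
  \<comment> \<open>The reflection along \<open>u = v - e\<^sub>0\<close> is \<open>1 - 2 u u\<^sup>T / (u \<bullet> u)\<close>, and \<open>u \<bullet> u = 2 c\<close>.
  For \<open>v = e\<^sub>0\<close> division by \<open>c = 0\<close> gives \<open>0\<close>, so \<open>H\<close> is the identity, as it should be.\<close>
  define c where "c = 1 - v $ 0"
  define u where "u i = v $ i - (if i = 0 then 1 else 0)" for i
  define H where "H = mat n n (\<lambda>(i,j). (if i = j then 1 else 0) - u i * u j / c)"
  have H: "H \<in> carrier_mat n n" by (simp add: H_def)
  have sum_v: "(\<Sum>i<n. (v $ i)\<^sup>2) = 1" using v by (simp add: scalar_prod_self_sum)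
  have "(\<Sum>i<n. (u i)\<^sup>2) = (\<Sum>i<n. (v $ i)\<^sup>2 + (if i = 0 then 1 - 2 * v $ 0 else 0))"
    by (intro sum.cong) (auto simp: u_def power2_eq_square algebra_simps)
  then have sum_u: "(\<Sum>i<n. (u i)\<^sup>2) = 2 * c"
    using n sum_v by (simp add: sum.distrib c_def)
  have u0: "u i = 0" if "c = 0" "i < n" for i
  proof -
    have "(\<Sum>i<n. (u i)\<^sup>2) = 0" using sum_u that(1) by simp
    then have "\<forall>i\<in>{..<n}. (u i)\<^sup>2 = 0"
      by (subst (asm) sum_nonneg_eq_0_iff) auto
    then show ?thesis using that(2) by simp
  qed
  have symH: "H\<^sup>T = H" by (rule eq_matI) (auto simp: H_def)
  have HH: "H * H = 1\<^sub>m n"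
  proof (rule eq_matI)
    fix i j assume "i < dim_row (1\<^sub>m n)" "j < dim_col (1\<^sub>m n)"
    then have ij: "i < n" "j < n" by auto
    have "(H * H) $$ (i,j) = (\<Sum>k<n. ((if i = k then 1 else 0) - u i * u k / c) * ((if k = j then 1 else 0) - u k * u j / c))"
      using ij by (simp add: H_def scalar_prod_def atLeast0LessThan)
    also have "\<dots> = (\<Sum>k<n. (if k = i then (if i = j then 1 else 0) - u i * u j / c else 0)
        - (if k = j then u i * u j / c else 0) + u i * u j / (c * c) * (u k)\<^sup>2)"
      by (intro sum.cong) (auto simp: power2_eq_square algebra_simps)
    also have "\<dots> = (if i = j then 1 else 0) - u i * u j / c - u i * u j / c + u i * u j / (c * c) * (2 * c)"
      unfolding sum.distrib sum_subtractf sum_distrib_left[symmetric] sum_u using ij by simp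
    also have "\<dots> = (if i = j then 1 else 0)"
      by (cases "c = 0") (auto simp: field_simps)
    finally show "(H * H) $$ (i,j) = 1\<^sub>m n $$ (i,j)" using ij by simp
  qed (use H in auto)
  show ?thesis
  proof (rule that)
    show "orthonormal_mat n H" using H HH symH by (simp add: orthonormal_mat_def)
    show "col H 0 = v"
    proof (rule eq_vecI)
      fix i assume "i < dim_vec v"
      then have i: "i < n" using v by simp
      have "col H 0 $ i = (if i = 0 then 1 else 0) - u i * u 0 / c" using i n by (simp add: H_def)
      also have "u 0 = - c" by (simp add: u_def c_def)
      also have "u i * (- c) / c = - u i" using u0[of i] i by (cases "c = 0") auto
      finally show "col H 0 $ i = v $ i" by (simp add: u_def)
    qed (use v H in auto)
  qed
qed

definition diagonalizes :: "nat \<Rightarrow> real mat \<Rightarrow> (nat \<Rightarrow> real) \<Rightarrow> real mat \<Rightarrow> bool" where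
  "diagonalizes n U d A \<longleftrightarrow> orthonormal_mat n U \<and> A = U * mat_diag n d * U\<^sup>T"

lemma orthonormal_mat_mult:
  assumes "orthonormal_mat n U" "orthonormal_mat n W"
  shows "orthonormal_mat n (U * W)"
proof -
  have c: "U \<in> carrier_mat n n" "W \<in> carrier_mat n n" "U\<^sup>T \<in> carrier_mat n n" "W\<^sup>T \<in> carrier_mat n n"
    and U: "U\<^sup>T * U = 1\<^sub>m n" "U * U\<^sup>T = 1\<^sub>m n" and W: "W\<^sup>T * W = 1\<^sub>m n" "W * W\<^sup>T = 1\<^sub>m n"
    using assms by (auto simp: orthonormal_mat_def)
  have "(U * W)\<^sup>T * (U * W) = W\<^sup>T * ((U\<^sup>T * U) * W)"
    using c by (simp add: transpose_mult[of _ n n _ n] assoc_mult_mat[of _ n n _ n _ n])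
  moreover have "(U * W) * (U * W)\<^sup>T = U * ((W * W\<^sup>T) * U\<^sup>T)"
    using c by (simp add: transpose_mult[of _ n n _ n] assoc_mult_mat[of _ n n _ n _ n])
  ultimately show ?thesis using c U W by (simp add: orthonormal_mat_def)
qed

lemma diagonalizes_congruence:
  assumes A: "A \<in> carrier_mat n n" and H: "orthonormal_mat n H"
    and F: "diagonalizes n F d (H\<^sup>T * A * H)"
  shows "diagonalizes n (H * F) d A"
proof -
  have assoc5: "P * (Q * R * S) * T = (P * Q) * R * (S * T)"
    if "P \<in> carrier_mat n n" "Q \<in> carrier_mat n n" "R \<in> carrier_mat n n"
      "S \<in> carrier_mat n n" "T \<in> carrier_mat n n" for P Q R S T :: "real mat"
    using that by (simp add: assoc_mult_mat[of _ n n _ n _ n] del: assoc_mult_mat)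
  have Hc: "H \<in> carrier_mat n n" "H\<^sup>T \<in> carrier_mat n n" and HHt: "H * H\<^sup>T = 1\<^sub>m n"
    using H by (auto simp: orthonormal_mat_def)
  have Fc: "F \<in> carrier_mat n n" "F\<^sup>T \<in> carrier_mat n n"
    using F by (auto simp: orthonormal_mat_def diagonalizes_def)
  have "A = (H * H\<^sup>T) * A * (H * H\<^sup>T)" using A HHt by simp
  also have "\<dots> = H * (H\<^sup>T * A * H) * H\<^sup>T" using assoc5[OF Hc A Hc] ..
  also have "\<dots> = H * (F * mat_diag n d * F\<^sup>T) * H\<^sup>T"
    using F by (simp add: diagonalizes_def)
  also have "\<dots> = H * F * mat_diag n d * (H * F)\<^sup>T"
    using assoc5[OF Hc(1) Fc(1) mat_diag_dim Fc(2) Hc(2)] transpose_mult[OF Hc(1) Fc(1)] by simp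
  finally show ?thesis
    using orthonormal_mat_mult[OF H] F by (simp add: diagonalizes_def)
qed

text \<open>Spectral theorem, by deflation: in an orthonormal basis that starts with an eigenvector the
  matrix has the block form \<open>diag (e, A')\<close> with \<open>A'\<close> symmetric of smaller size.\<close>

theorem symmetric_diagonalizable:
  assumes "A \<in> carrier_mat n n" "A\<^sup>T = A"
  shows "\<exists>U d. diagonalizes n U d A"
  using assms
proof (induction n arbitrary: A)
  case 0
  then have "diagonalizes 0 (1\<^sub>m 0) (\<lambda>_. 0) A"
    by (auto simp: diagonalizes_def orthonormal_mat_def)
  then show ?case by blast
next
  case (Suc m)
  let ?n = "Suc m"
  note A = Suc.prems(1) and sym = Suc.prems(2)
  obtain e v where v: "v \<in> carrier_vec ?n" "v \<bullet> v = 1" "A *\<^sub>v v = e \<cdot>\<^sub>v v"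
    using symmetric_real_eigenvector[OF A sym] by blast
  obtain H where H: "orthonormal_mat ?n H" and colH: "col H 0 = v"
    using orthonormal_mat_with_first_column[OF v(1,2)] by auto
  have Hc: "H \<in> carrier_mat ?n ?n" "H\<^sup>T \<in> carrier_mat ?n ?n"
    and HtH: "H\<^sup>T * H = 1\<^sub>m ?n" and HHt: "H * H\<^sup>T = 1\<^sub>m ?n"
    using H by (auto simp: orthonormal_mat_def)
  define B where "B = H\<^sup>T * A * H"
  have B: "B \<in> carrier_mat ?n ?n" using A Hc by (simp add: B_def)
  have symB: "B\<^sup>T = B"
    unfolding B_def by (rule symmetric_congruence[OF A Hc(1) sym])
  have B_swap: "B $$ (j,i) = B $$ (i,j)" if "i < ?n" "j < ?n" for i j
    using B that by (subst symB[symmetric]) simp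
  have colB: "col B 0 = e \<cdot>\<^sub>v unit_vec ?n 0"
  proof -
    have "col B 0 = (H\<^sup>T * A) *\<^sub>v v"
      unfolding B_def col_mult2[OF mult_carrier_mat[OF Hc(2) A] Hc(1) zero_less_Suc] colH ..
    also have "\<dots> = H\<^sup>T *\<^sub>v (A *\<^sub>v v)" using A Hc v(1) by simp
    also have "\<dots> = e \<cdot>\<^sub>v (H\<^sup>T *\<^sub>v v)" unfolding v(3) using Hc v(1) by (simp add: mult_mat_vec)
    also have "H\<^sup>T *\<^sub>v v = col (H\<^sup>T * H) 0"
      unfolding col_mult2[OF Hc(2,1) zero_less_Suc] colH ..
    finally show ?thesis by (simp add: HtH)
  qed
  have B0: "B $$ (i,0) = (if i = 0 then e else 0)" if "i < ?n" for i
    using arg_cong[OF colB, of "\<lambda>w. w $ i"] that B by (auto simp: unit_vec_def)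
  have B0': "B $$ (0,i) = (if i = 0 then e else 0)" if "i < ?n" for i
    using B0[OF that] B_swap[OF that, of 0] by simp
  define A' where "A' = mat m m (\<lambda>(i,j). B $$ (Suc i, Suc j))"
  let ?E = "mat 1 1 (\<lambda>_. e)"
  have A': "A' \<in> carrier_mat m m" by (simp add: A'_def)
  have blockB: "B = four_block_mat ?E (0\<^sub>m 1 m) (0\<^sub>m m 1) A'"
    using B B0 B0' by (intro eq_matI) (auto simp: A'_def)
  have "A'\<^sup>T = A'"
    using B_swap by (intro eq_matI) (auto simp: A'_def)
  from Suc.IH[OF A' this] obtain W d where W: "orthonormal_mat m W" and A'eq: "A' = W * mat_diag m d * W\<^sup>T"
    by (auto simp: diagonalizes_def)
  have Wc: "W \<in> carrier_mat m m" "W\<^sup>T \<in> carrier_mat m m"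
    and WW: "W\<^sup>T * W = 1\<^sub>m m" "W * W\<^sup>T = 1\<^sub>m m"
    using W by (auto simp: orthonormal_mat_def)
  let ?F = "four_block_mat (1\<^sub>m 1) (0\<^sub>m 1 m) (0\<^sub>m m 1) W"
  let ?d = "case_nat e d"
  have F: "?F \<in> carrier_mat ?n ?n" using Wc by (metis four_block_carrier_mat one_carrier_mat plus_1_eq_Suc)
  have Ft: "?F\<^sup>T = four_block_mat (1\<^sub>m 1) (0\<^sub>m 1 m) (0\<^sub>m m 1) (W\<^sup>T)"
    using Wc by (subst transpose_four_block_mat[of _ 1 1 _ m _ m]) auto
  have D: "mat_diag ?n ?d = four_block_mat ?E (0\<^sub>m 1 m) (0\<^sub>m m 1) (mat_diag m d)"
    by (rule eq_matI) (auto simp: mat_diag_def split: nat.split)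
  have block_mult: "four_block_mat P (0\<^sub>m 1 m) (0\<^sub>m m 1) X * four_block_mat Q (0\<^sub>m 1 m) (0\<^sub>m m 1) Y
      = four_block_mat (P * Q) (0\<^sub>m 1 m) (0\<^sub>m m 1) (X * Y)"
    if "P \<in> carrier_mat 1 1" "Q \<in> carrier_mat 1 1" "X \<in> carrier_mat m m" "Y \<in> carrier_mat m m"
    for P Q X Y :: "real mat"
    using that by (subst mult_four_block_mat[of _ 1 1 _ m _ m _ _ 1 _ m]) auto
  have orthF: "orthonormal_mat ?n ?F"
    using F Wc by (simp add: orthonormal_mat_def Ft block_mult WW plus_1_eq_Suc del: One_nat_def)
  have FDF: "?F * mat_diag ?n ?d * ?F\<^sup>T = B"
    using Wc by (simp add: Ft D blockB A'eq block_mult del: assoc_mult_mat One_nat_def)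
  then have "diagonalizes ?n (H * ?F) ?d A"
    using orthF by (intro diagonalizes_congruence[OF A H]) (auto simp: diagonalizes_def B_def)
  then show ?case by blast
qed

section \<open>Coordinates in an eigenbasis and sorted spectra\<close>

lemma orthonormal_mat_isometry:
  assumes U: "orthonormal_mat n U" and x: "x \<in> carrier_vec n" and y: "y \<in> carrier_vec n"
  shows "(U\<^sup>T *\<^sub>v x) \<bullet> (U\<^sup>T *\<^sub>v y) = x \<bullet> y"
proof -
  have Uc: "U \<in> carrier_mat n n" "U\<^sup>T \<in> carrier_mat n n" and UU: "U * U\<^sup>T = 1\<^sub>m n"
    using U by (auto simp: orthonormal_mat_def)
  have "(U\<^sup>T *\<^sub>v x) \<bullet> (U\<^sup>T *\<^sub>v y) = x \<bullet> (U *\<^sub>v (U\<^sup>T *\<^sub>v y))"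
    using transpose_vec_mult_scalar[OF Uc(1) _ x, of "U\<^sup>T *\<^sub>v y"] Uc y by simp
  also have "U *\<^sub>v (U\<^sup>T *\<^sub>v y) = (U * U\<^sup>T) *\<^sub>v y"
    using assoc_mult_mat_vec[OF Uc y] by simp
  finally show ?thesis using y UU by simp
qed

lemma diagonalizes_carrier:
  assumes "diagonalizes n U d A"
  shows "A \<in> carrier_mat n n" "U \<in> carrier_mat n n" "orthonormal_mat n U"
  using assms by (auto simp: diagonalizes_def orthonormal_mat_def)

lemma mat_diag_mult_vec_index:
  assumes "x \<in> carrier_vec n" "j < n"
  shows "(mat_diag n d *\<^sub>v x) $ j = (d j :: real) * x $ j"
proof -
  have "(mat_diag n d *\<^sub>v x) $ j = (\<Sum>i<n. (if j = i then d i else 0) * x $ i)"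
    using assms unfolding mat_diag_def by (simp add: scalar_prod_def atLeast0LessThan)
  also have "\<dots> = (\<Sum>i<n. if j = i then d j * x $ j else 0)"
    by (intro sum.cong) auto
  finally have "(mat_diag n d *\<^sub>v x) $ j = (\<Sum>i<n. if j = i then d j * x $ j else 0)" .
  then show ?thesis using assms by simp
qed

lemma diagonalizes_coordinate:
  assumes "diagonalizes n U d A" and x: "x \<in> carrier_vec n" and j: "j < n"
  shows "(U\<^sup>T *\<^sub>v (A *\<^sub>v x)) $ j = d j * (U\<^sup>T *\<^sub>v x) $ j"
proof -
  have Uc: "U \<in> carrier_mat n n" "U\<^sup>T \<in> carrier_mat n n" and UU: "U\<^sup>T * U = 1\<^sub>m n"
    and A: "A = U * mat_diag n d * U\<^sup>T"
    using assms(1) by (auto simp: diagonalizes_def orthonormal_mat_def)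
  have Ux: "U\<^sup>T *\<^sub>v x \<in> carrier_vec n" "mat_diag n d *\<^sub>v (U\<^sup>T *\<^sub>v x) \<in> carrier_vec n"
    using Uc x by (auto intro!: mult_mat_vec_carrier)
  have "A *\<^sub>v x = U *\<^sub>v (mat_diag n d *\<^sub>v (U\<^sup>T *\<^sub>v x))"
    unfolding A using Uc x
    by (simp add: assoc_mult_mat_vec[of _ n n _ n] mult_carrier_mat[of _ n n] del: assoc_mult_mat)
  then have "U\<^sup>T *\<^sub>v (A *\<^sub>v x) = (U\<^sup>T * U) *\<^sub>v (mat_diag n d *\<^sub>v (U\<^sup>T *\<^sub>v x))"
    using assoc_mult_mat_vec[OF Uc(2,1) Ux(2)] by simp
  also have "\<dots> = mat_diag n d *\<^sub>v (U\<^sup>T *\<^sub>v x)" using Ux by (simp add: UU)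
  finally show ?thesis using mat_diag_mult_vec_index[OF Ux(1) j] by simp
qed

lemma orthonormal_mat_parseval:
  assumes "orthonormal_mat n U" "x \<in> carrier_vec n"
  shows "x \<bullet> x = (\<Sum>j<n. ((U\<^sup>T *\<^sub>v x) $ j)\<^sup>2)"
proof -
  have "U \<in> carrier_mat n n" using assms by (simp add: orthonormal_mat_def)
  then show ?thesis
    using orthonormal_mat_isometry[OF assms assms(2)] scalar_prod_self_sum[of "U\<^sup>T *\<^sub>v x"] by simp
qed

lemma diagonalizes_quadratic_form:
  assumes d: "diagonalizes n U d A" and x: "x \<in> carrier_vec n"
  shows "x \<bullet> (A *\<^sub>v x) = (\<Sum>j<n. d j * ((U\<^sup>T *\<^sub>v x) $ j)\<^sup>2)"
proof -
  note c = diagonalizes_carrier[OF d]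
  have Ax: "A *\<^sub>v x \<in> carrier_vec n" using c x by auto
  have "x \<bullet> (A *\<^sub>v x) = (\<Sum>j<n. (U\<^sup>T *\<^sub>v x) $ j * (U\<^sup>T *\<^sub>v (A *\<^sub>v x)) $ j)"
    unfolding orthonormal_mat_isometry[OF c(3) x Ax, symmetric]
    using c(2) by (auto simp: scalar_prod_def atLeast0LessThan intro!: sum.cong)
  also have "\<dots> = (\<Sum>j<n. d j * ((U\<^sup>T *\<^sub>v x) $ j)\<^sup>2)"
    by (intro sum.cong) (auto simp: diagonalizes_coordinate[OF d x] power2_eq_square)
  finally show ?thesis .
qed

lemma diagonalizes_norm_image:
  assumes d: "diagonalizes n U d A" and x: "x \<in> carrier_vec n"
  shows "(A *\<^sub>v x) \<bullet> (A *\<^sub>v x) = (\<Sum>j<n. (d j)\<^sup>2 * ((U\<^sup>T *\<^sub>v x) $ j)\<^sup>2)"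
proof -
  note c = diagonalizes_carrier[OF d]
  have Ax: "A *\<^sub>v x \<in> carrier_vec n" using c x by auto
  show ?thesis unfolding orthonormal_mat_parseval[OF c(3) Ax]
    by (intro sum.cong) (auto simp: diagonalizes_coordinate[OF d x] power_mult_distrib)
qed

lemma diagonalizes_entry:
  assumes "U \<in> carrier_mat n n" "r < n" "s < n"
  shows "(U * mat_diag n d * U\<^sup>T) $$ (r,s) = (\<Sum>k<n. U $$ (r,k) * d k * U $$ (s,k))"
  using assms
  by (subst mat_diag_mult_right[OF assms(1)])
     (auto simp: scalar_prod_def atLeast0LessThan intro!: sum.cong)

lemma proots_prod_linear_factors:
  "proots (\<Prod>a\<leftarrow>xs. [:- a, 1:]) = mset (xs :: real list)"
proof (induction xs)
  case (Cons a xs)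
  have "(\<Prod>a\<leftarrow>xs. [:- a, 1:]) \<noteq> 0" by (auto simp: prod_list_zero_iff)
  then show ?case using Cons by (simp add: proots_mult del: mult_pCons_left)
qed simp

lemma diagonalizes_eigs_desc:
  assumes d: "diagonalizes n U d A"
  shows "eigs_desc A = rev (sort (map d [0..<n]))"
proof -
  have Uc: "U \<in> carrier_mat n n" "U\<^sup>T \<in> carrier_mat n n" and UU: "U\<^sup>T * U = 1\<^sub>m n" "U * U\<^sup>T = 1\<^sub>m n"
    and A: "A = U * mat_diag n d * U\<^sup>T"
    using d by (auto simp: diagonalizes_def orthonormal_mat_def)
  have "similar_mat_wit A (mat_diag n d) U (U\<^sup>T)"
    by (rule similar_mat_witI[of _ _ n]) (use Uc UU A in auto)
  then have "char_poly A = char_poly (mat_diag n d)"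
    by (intro char_poly_similar) (auto simp: similar_mat_def)
  also have "\<dots> = (\<Prod>a\<leftarrow>diag_mat (mat_diag n d). [:- a, 1:])"
    by (rule char_poly_upper_triangular[OF mat_diag_dim]) (auto simp: mat_diag_def)
  also have "diag_mat (mat_diag n d) = map d [0..<n]"
    by (auto simp: diag_mat_def mat_diag_def)
  finally show ?thesis
    by (simp only: eigs_desc_def proots_prod_linear_factors sorted_list_of_multiset_mset)
qed

lemma rev_sort_map_antimono:
  fixes d :: "nat \<Rightarrow> real"
  assumes "\<And>i j. i \<le> j \<Longrightarrow> j < n \<Longrightarrow> d j \<le> d i"
  shows "rev (sort (map d [0..<n])) = map d [0..<n]"
proof -
  have "sorted (rev (map d [0..<n]))"
    using assms by (auto simp: sorted_iff_nth_mono rev_nth)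
  then have "sort (map d [0..<n]) = rev (map d [0..<n])"
    by (intro properties_for_sort) auto
  then show ?thesis by simp
qed

lemma diagonalizes_eig:
  assumes "diagonalizes n U d A" "\<And>i j. i \<le> j \<Longrightarrow> j < n \<Longrightarrow> d j \<le> d i" "j < n"
  shows "eig A (Suc j) = d j"
  using assms(3) by (simp add: eig_def diagonalizes_eigs_desc[OF assms(1)] rev_sort_map_antimono[OF assms(2)])

lemma diagonalizes_permute:
  assumes d: "diagonalizes n U d A" and p: "p permutes {..<n}"
  shows "diagonalizes n (mat n n (\<lambda>(r,c). U $$ (r, p c))) (d \<circ> p) A"
proof -
  let ?W = "mat n n (\<lambda>(r,c). U $$ (r, p c))"
  have Uc: "U \<in> carrier_mat n n" and UU: "U\<^sup>T * U = 1\<^sub>m n"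
    and A: "A = U * mat_diag n d * U\<^sup>T"
    using d by (auto simp: diagonalizes_def orthonormal_mat_def)
  have pn: "p i < n" if "i < n" for i using permutes_in_image[OF p, of i] that by auto
  have "?W\<^sup>T * ?W = 1\<^sub>m n"
  proof (rule eq_matI)
    fix i j assume "i < dim_row (1\<^sub>m n)" "j < dim_col (1\<^sub>m n)"
    then have ij: "i < n" "j < n" by auto
    have "(?W\<^sup>T * ?W) $$ (i,j) = (U\<^sup>T * U) $$ (p i, p j)"
      using ij pn Uc by (simp add: scalar_prod_def)
    also have "\<dots> = (1\<^sub>m n) $$ (i,j)"
      unfolding UU using ij pn permutes_inj[OF p] by (auto simp: inj_eq)
    finally show "(?W\<^sup>T * ?W) $$ (i,j) = (1\<^sub>m n) $$ (i,j)" .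
  qed auto
  then have "orthonormal_mat n ?W"
    using mat_mult_left_right_inverse[of "?W\<^sup>T" n ?W] by (auto simp: orthonormal_mat_def)
  moreover have "A = ?W * mat_diag n (d \<circ> p) * ?W\<^sup>T"
  proof (rule eq_matI)
    fix r s assume "r < dim_row (?W * mat_diag n (d \<circ> p) * ?W\<^sup>T)" "s < dim_col (?W * mat_diag n (d \<circ> p) * ?W\<^sup>T)"
    then have rs: "r < n" "s < n" by auto
    have "A $$ (r,s) = (\<Sum>k<n. U $$ (r,k) * d k * U $$ (s,k))"
      unfolding A by (rule diagonalizes_entry[OF Uc rs])
    also have "\<dots> = (\<Sum>k<n. U $$ (r,p k) * d (p k) * U $$ (s,p k))"
      using sum.permute[OF p, of "\<lambda>k. U $$ (r,k) * d k * U $$ (s,k)"] by (simp add: o_def)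
    also have "\<dots> = (?W * mat_diag n (d \<circ> p) * ?W\<^sup>T) $$ (r,s)"
      using rs by (subst diagonalizes_entry[of _ n]) auto
    finally show "A $$ (r,s) = (?W * mat_diag n (d \<circ> p) * ?W\<^sup>T) $$ (r,s)" .
  qed (use diagonalizes_carrier[OF d] in auto)
  ultimately show ?thesis by (simp add: diagonalizes_def)
qed

lemma diagonalizes_cong:
  assumes "diagonalizes n U d A" "\<And>j. j < n \<Longrightarrow> d j = d' j"
  shows "diagonalizes n U d' A"
proof -
  have "mat_diag n d = mat_diag n d'"
    using assms(2) by (auto simp: mat_diag_def intro!: cong_mat)
  then show ?thesis using assms(1) by (simp add: diagonalizes_def)
qed

text \<open>Permuting the columns of an arbitrary diagonalization puts the eigenvalues in non-increasing
  order. Since the spectrum is read off the characteristic polynomial, the ordered diagonal then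
  agrees with \<^const>\<open>eig\<close>.\<close>

theorem symmetric_eigendecomposition:
  assumes A: "A \<in> carrier_mat n n" "A\<^sup>T = A"
  obtains U where "diagonalizes n U (\<lambda>j. eig A (Suc j)) A"
    and "\<And>i j. i \<le> j \<Longrightarrow> j < n \<Longrightarrow> eig A (Suc j) \<le> eig A (Suc i)"
proof -
  obtain U d where d: "diagonalizes n U d A" using symmetric_diagonalizable[OF A] by blast
  let ?xs = "map d [0..<n]"
  obtain p where p: "p permutes {..<n}" "permute_list p ?xs = rev (sort ?xs)"
    using mset_eq_permutation[of "rev (sort ?xs)" ?xs] by auto
  let ?W = "mat n n (\<lambda>(r,c). U $$ (r, p c))"
  have pn: "p i < n" if "i < n" for i using permutes_in_image[OF p(1), of i] that by auto
  have dp: "(d \<circ> p) j = rev (sort ?xs) ! j" if "j < n" for j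
    unfolding p(2)[symmetric] using that pn p(1) by (simp add: permute_list_nth)
  have sorted: "(d \<circ> p) j \<le> (d \<circ> p) i" if "i \<le> j" "j < n" for i j
  proof -
    have "sort ?xs ! (n - Suc j) \<le> sort ?xs ! (n - Suc i)"
      using that by (intro sorted_nth_mono) auto
    then show ?thesis using that by (simp add: dp rev_nth del: o_apply)
  qed
  note W = diagonalizes_permute[OF d p(1)]
  have eig: "eig A (Suc j) = (d \<circ> p) j" if "j < n" for j
    using diagonalizes_eig[OF W sorted that] by simp
  show ?thesis
  proof (rule that)
    show "diagonalizes n ?W (\<lambda>j. eig A (Suc j)) A"
      by (rule diagonalizes_cong[OF W]) (simp add: eig)
    show "eig A (Suc j) \<le> eig A (Suc i)" if "i \<le> j" "j < n" for i j
      using sorted[OF that] eig[of i] eig[of j] that by simp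
  qed
qed

lemma eig_antimono:
  assumes "A \<in> carrier_mat n n" "A\<^sup>T = A" "i \<le> j" "j < n"
  shows "eig A (Suc j) \<le> eig A (Suc i)"
  using symmetric_eigendecomposition[OF assms(1,2)] assms(3,4) by metis

section \<open>Variational bounds for eigenvalues\<close>

text \<open>Padding with a zero row makes the matrix square and singular.\<close>

lemma wide_matrix_kernel:
  fixes B :: "real mat"
  assumes B: "B \<in> carrier_mat m (Suc m)"
  obtains w where "w \<in> carrier_vec (Suc m)" "w \<noteq> 0\<^sub>v (Suc m)" "B *\<^sub>v w = 0\<^sub>v m"
proof -
  define C where "C = mat (Suc m) (Suc m) (\<lambda>(r,s). if r < m then B $$ (r,s) else 0)"
  have C: "C \<in> carrier_mat (Suc m) (Suc m)" by (simp add: C_def)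
  have "C\<^sup>T *\<^sub>v unit_vec (Suc m) m = 0\<^sub>v (Suc m)"
    using C by (intro eq_vecI) (auto simp: C_def)
  moreover have "unit_vec (Suc m) m \<noteq> (0\<^sub>v (Suc m) :: real vec)"
    by (metis index_unit_vec(1) index_zero_vec(1) lessI zero_neq_one)
  ultimately have "det (C\<^sup>T) = 0"
    using C unit_vec_carrier[of "Suc m" m]
    by (subst det_0_iff_vec_prod_zero[of _ "Suc m"]) (simp, blast)
  then have "det C = 0" using det_transpose[OF C] by simp
  then obtain w where w: "w \<in> carrier_vec (Suc m)" "w \<noteq> 0\<^sub>v (Suc m)" "C *\<^sub>v w = 0\<^sub>v (Suc m)"
    using det_0_iff_vec_prod_zero[OF C] by auto
  have "B *\<^sub>v w = 0\<^sub>v m"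
  proof (rule eq_vecI)
    fix r assume "r < dim_vec (0\<^sub>v m :: real vec)"
    then have r: "r < m" by simp
    have "(C *\<^sub>v w) $ r = (B *\<^sub>v w) $ r"
      using r B w(1) by (auto simp: C_def scalar_prod_def intro!: sum.cong)
    then show "(B *\<^sub>v w) $ r = 0\<^sub>v m $ r" using w(3) r by simp
  qed (use B in auto)
  with w that show ?thesis by blast
qed

text \<open>The half of the Courant--Fischer principle that produces lower bounds: if the Rayleigh quotient
  is at least \<open>c\<close> on a subspace of dimension \<open>m + 1\<close>, here the range of an injective \<open>Z\<close>,
  then so is the eigenvalue number \<open>m + 1\<close>. Such a subspace contains a nonzero vector orthogonal
  to the top \<open>m\<close> eigenvectors, and there the Rayleigh quotient is at most that eigenvalue.\<close>

theorem courant_fischer_lower: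
  assumes A: "A \<in> carrier_mat n n" "A\<^sup>T = A" and m: "m < n"
    and Z: "Z \<in> carrier_mat n (Suc m)"
    and quad: "\<And>p. p \<in> carrier_vec (Suc m) \<Longrightarrow> p \<noteq> 0\<^sub>v (Suc m) \<Longrightarrow>
      0 < (Z *\<^sub>v p) \<bullet> (Z *\<^sub>v p) \<and> c * ((Z *\<^sub>v p) \<bullet> (Z *\<^sub>v p)) \<le> (Z *\<^sub>v p) \<bullet> (A *\<^sub>v (Z *\<^sub>v p))"
  shows "c \<le> eig A (Suc m)"
proof -
  obtain U where U: "diagonalizes n U (\<lambda>j. eig A (Suc j)) A"
    and mono: "\<And>i j. i \<le> j \<Longrightarrow> j < n \<Longrightarrow> eig A (Suc j) \<le> eig A (Suc i)"
    using symmetric_eigendecomposition[OF A] by blast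
  note Uc = diagonalizes_carrier[OF U]
  define B where "B = mat m (Suc m) (\<lambda>(r,s). (U\<^sup>T * Z) $$ (r,s))"
  obtain w where w: "w \<in> carrier_vec (Suc m)" "w \<noteq> 0\<^sub>v (Suc m)" "B *\<^sub>v w = 0\<^sub>v m"
    using wide_matrix_kernel[of B m] by (auto simp: B_def)
  define z where "z = Z *\<^sub>v w"
  have z: "z \<in> carrier_vec n" using Z w by (auto simp: z_def)
  have coord: "(U\<^sup>T *\<^sub>v z) $ r = 0" if r: "r < m" for r
  proof -
    have "U\<^sup>T *\<^sub>v z = (U\<^sup>T * Z) *\<^sub>v w"
      unfolding z_def using Uc Z w(1) by (subst assoc_mult_mat_vec[of _ n n _ "Suc m"]) auto
    moreover have "row B r = row (U\<^sup>T * Z) r"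
      using r m Uc Z by (intro eq_vecI) (auto simp: B_def)
    ultimately have "(U\<^sup>T *\<^sub>v z) $ r = (B *\<^sub>v w) $ r"
      using r m Uc Z by (simp add: B_def del: assoc_mult_mat_vec)
    then show ?thesis using w(3) r by simp
  qed
  have "c * (z \<bullet> z) \<le> (\<Sum>j<n. eig A (Suc j) * ((U\<^sup>T *\<^sub>v z) $ j)\<^sup>2)"
    using quad[OF w(1,2)] diagonalizes_quadratic_form[OF U z] by (simp add: z_def)
  also have "\<dots> \<le> (\<Sum>j<n. eig A (Suc m) * ((U\<^sup>T *\<^sub>v z) $ j)\<^sup>2)"
  proof (rule sum_mono)
    fix j assume "j \<in> {..<n}"
    then show "eig A (Suc j) * ((U\<^sup>T *\<^sub>v z) $ j)\<^sup>2 \<le> eig A (Suc m) * ((U\<^sup>T *\<^sub>v z) $ j)\<^sup>2"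
      using coord[of j] mono[of m j] by (cases "j < m") (auto intro!: mult_right_mono)
  qed
  also have "\<dots> = eig A (Suc m) * (z \<bullet> z)"
    by (simp add: orthonormal_mat_parseval[OF Uc(3) z] sum_distrib_left)
  finally show ?thesis using quad[OF w(1,2)] by (simp add: z_def mult_le_cancel_right)
qed

definition inclusion_mat :: "nat \<Rightarrow> nat \<Rightarrow> real mat" where
  "inclusion_mat n m = mat n m (\<lambda>(r,s). if r = s then 1 else 0)"

lemma inclusion_mat_carrier [simp]: "inclusion_mat n m \<in> carrier_mat n m"
  by (simp add: inclusion_mat_def)

lemma inclusion_mat_mult_vec:
  assumes "p \<in> carrier_vec m"
  shows "inclusion_mat n m *\<^sub>v p = vec n (\<lambda>j. if j < m then p $ j else 0)"
proof (rule eq_vecI)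
  fix j assume "j < dim_vec (vec n (\<lambda>j. if j < m then p $ j else 0))"
  then have j: "j < n" by simp
  have "(inclusion_mat n m *\<^sub>v p) $ j = (\<Sum>i<m. (if j = i then 1 else 0) * p $ i)"
    using assms j by (simp add: inclusion_mat_def scalar_prod_def atLeast0LessThan)
  also have "\<dots> = (\<Sum>i<m. if j = i then p $ j else 0)"
    by (intro sum.cong) auto
  finally show "(inclusion_mat n m *\<^sub>v p) $ j = vec n (\<lambda>j. if j < m then p $ j else 0) $ j"
    using j by simp
qed (simp add: inclusion_mat_def)

lemma sum_power2_inclusion:
  assumes "m \<le> n" "p \<in> carrier_vec m"
  shows "(\<Sum>j<n. ((inclusion_mat n m *\<^sub>v p) $ j)\<^sup>2) = p \<bullet> (p :: real vec)"
proof -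
  have "(\<Sum>j<n. ((inclusion_mat n m *\<^sub>v p) $ j)\<^sup>2) = (\<Sum>j<m. (p $ j)\<^sup>2)"
    using assms(1) by (intro sum.mono_neutral_cong_right) (auto simp: inclusion_mat_mult_vec[OF assms(2)])
  then show ?thesis using assms(2) by (simp add: scalar_prod_self_sum)
qed

text \<open>Weyl monotonicity: on the span of the top \<open>m + 1\<close> eigenvectors of \<open>A\<close> the Rayleigh
  quotient of \<open>A\<close>, hence also that of \<open>B\<close>, is at least the eigenvalue of \<open>A\<close>.\<close>

theorem eig_mono:
  assumes A: "A \<in> carrier_mat n n" "A\<^sup>T = A" and B: "B \<in> carrier_mat n n" "B\<^sup>T = B" and m: "m < n"
    and le: "\<And>x. x \<in> carrier_vec n \<Longrightarrow> x \<bullet> (A *\<^sub>v x) \<le> x \<bullet> (B *\<^sub>v x)"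
  shows "eig A (Suc m) \<le> eig B (Suc m)"
proof -
  obtain U where U: "diagonalizes n U (\<lambda>j. eig A (Suc j)) A"
    and mono: "\<And>i j. i \<le> j \<Longrightarrow> j < n \<Longrightarrow> eig A (Suc j) \<le> eig A (Suc i)"
    using symmetric_eigendecomposition[OF A] by blast
  note Uc = diagonalizes_carrier[OF U]
  define E where "E = inclusion_mat n (Suc m)"
  have E: "E \<in> carrier_mat n (Suc m)" by (simp add: E_def)
  show ?thesis
  proof (rule courant_fischer_lower[OF B m, of "U * E"])
    show UE: "U * E \<in> carrier_mat n (Suc m)" using Uc E by auto
    fix p :: "real vec" assume p: "p \<in> carrier_vec (Suc m)" "p \<noteq> 0\<^sub>v (Suc m)"
    define z where "z = (U * E) *\<^sub>v p"
    have z: "z \<in> carrier_vec n" using UE p by (auto simp: z_def)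
    have Ep: "E *\<^sub>v p \<in> carrier_vec n" using E p by auto
    have "U\<^sup>T *\<^sub>v z = (U\<^sup>T * U) *\<^sub>v (E *\<^sub>v p)"
      unfolding z_def using Uc E p Ep
      by (simp add: assoc_mult_mat_vec[of _ n n _ n] assoc_mult_mat_vec[of _ n n _ "Suc m"])
    also have "\<dots> = E *\<^sub>v p" using Uc Ep by (simp add: orthonormal_mat_def)
    finally have coord: "U\<^sup>T *\<^sub>v z = E *\<^sub>v p" .
    have zz: "z \<bullet> z = p \<bullet> p"
      unfolding orthonormal_mat_parseval[OF Uc(3) z] coord E_def
      using m p by (intro sum_power2_inclusion) auto
    have "eig A (Suc m) * (z \<bullet> z) = (\<Sum>j<n. eig A (Suc m) * ((E *\<^sub>v p) $ j)\<^sup>2)"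
      unfolding orthonormal_mat_parseval[OF Uc(3) z] coord by (simp add: sum_distrib_left)
    also have "\<dots> \<le> (\<Sum>j<n. eig A (Suc j) * ((E *\<^sub>v p) $ j)\<^sup>2)"
    proof (rule sum_mono)
      fix j assume "j \<in> {..<n}"
      then show "eig A (Suc m) * ((E *\<^sub>v p) $ j)\<^sup>2 \<le> eig A (Suc j) * ((E *\<^sub>v p) $ j)\<^sup>2"
        using mono[of j m] m
        by (cases "j \<le> m") (auto simp: E_def inclusion_mat_mult_vec[OF p(1)] intro!: mult_right_mono)
    qed
    also have "\<dots> = z \<bullet> (A *\<^sub>v z)" using diagonalizes_quadratic_form[OF U z] coord by simp
    also have "\<dots> \<le> z \<bullet> (B *\<^sub>v z)" by (rule le[OF z])
    finally show "0 < ((U * E) *\<^sub>v p) \<bullet> ((U * E) *\<^sub>v p) \<and>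
        eig A (Suc m) * (((U * E) *\<^sub>v p) \<bullet> ((U * E) *\<^sub>v p)) \<le> ((U * E) *\<^sub>v p) \<bullet> (B *\<^sub>v ((U * E) *\<^sub>v p))"
      using zz scalar_prod_self_pos[OF p] by (simp add: z_def)
  qed
qed

section \<open>The Moore--Penrose pseudoinverse\<close>

text \<open>Penrose's argument: \<open>A X\<close> and \<open>A Y\<close> are symmetric idempotents with the same range, hence
  equal, and likewise \<open>X A\<close> and \<open>Y A\<close>. Therefore \<open>X = X A X = Y A Y = Y\<close>.\<close>

lemma is_pinv_unique:
  assumes X: "is_pinv A X" and Y: "is_pinv A Y"
  shows "X = Y"
proof -
  define m n where "m = dim_row A" and "n = dim_col A"
  have c: "A \<in> carrier_mat m n" "X \<in> carrier_mat n m" "Y \<in> carrier_mat n m"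
    using X Y by (auto simp: is_pinv_def m_def n_def)
  have AX: "A * X = A * Y"
  proof -
    have "A * X = (A * Y * A) * X" using Y by (simp add: is_pinv_def)
    also have "\<dots> = (A * Y) * (A * X)" using c by (simp add: mat_mult_assoc_dim)
    also have "\<dots> = (A * Y)\<^sup>T * (A * X)\<^sup>T" using X Y by (simp add: is_pinv_def)
    also have "\<dots> = ((A * X) * (A * Y))\<^sup>T" using c by (subst transpose_mult[of _ m m _ m]) auto
    also have "(A * X) * (A * Y) = (A * X * A) * Y" using c by (subst assoc_mult_mat[of _ m m _ n _ m]) auto
    also have "\<dots> = A * Y" using X by (simp add: is_pinv_def)
    finally show ?thesis using Y by (simp add: is_pinv_def)
  qed
  have XA: "X * A = Y * A"
  proof -
    have "X * A = X * (A * Y * A)" using Y by (simp add: is_pinv_def)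
    also have "\<dots> = (X * A) * (Y * A)" using c by (simp add: mat_mult_assoc_dim)
    also have "\<dots> = (X * A)\<^sup>T * (Y * A)\<^sup>T" using X Y by (simp add: is_pinv_def)
    also have "\<dots> = ((Y * A) * (X * A))\<^sup>T" using c by (subst transpose_mult[of _ n n _ n]) auto
    also have "(Y * A) * (X * A) = Y * (A * X * A)" using c by (simp add: mat_mult_assoc_dim)
    also have "\<dots> = Y * A" using X by (simp add: is_pinv_def)
    finally show ?thesis using Y by (simp add: is_pinv_def)
  qed
  have "X = X * A * X" using X by (simp add: is_pinv_def)
  also have "\<dots> = Y * A * X" by (simp only: XA)
  also have "\<dots> = Y * (A * X)" using c by simp
  also have "\<dots> = Y * A * Y" using c AX by simp
  also have "\<dots> = Y" using Y by (simp add: is_pinv_def)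
  finally show ?thesis .
qed

lemma is_pinv_transpose:
  assumes "is_pinv A X"
  shows "is_pinv (A\<^sup>T) (X\<^sup>T)"
proof -
  define m n where "m = dim_row A" and "n = dim_col A"
  have c: "A \<in> carrier_mat m n" "X \<in> carrier_mat n m"
    using assms by (auto simp: is_pinv_def m_def n_def)
  have AX: "A\<^sup>T * X\<^sup>T = (X * A)\<^sup>T" "X\<^sup>T * A\<^sup>T = (A * X)\<^sup>T"
    using c by (auto simp: transpose_mult_dim)
  have "A\<^sup>T * X\<^sup>T * A\<^sup>T = (A * (X * A))\<^sup>T" "X\<^sup>T * A\<^sup>T * X\<^sup>T = (X * (A * X))\<^sup>T"
    unfolding AX using c by (auto simp: transpose_mult_dim)
  then show ?thesis using assms c unfolding is_pinv_def AX by auto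
qed

text \<open>Since \<open>M = M X M\<close>, each \<open>x - X M x\<close> lies in the kernel of \<open>M\<close>. A matrix that
  vanishes there cannot distinguish \<open>x\<close> from \<open>X M x\<close>.\<close>

lemma mat_mult_is_pinv_absorb:
  fixes B :: "real mat"
  assumes M: "M \<in> carrier_mat n m" and X: "is_pinv M X" and B: "B \<in> carrier_mat r m"
    and ker: "\<And>y. y \<in> carrier_vec m \<Longrightarrow> M *\<^sub>v y = 0\<^sub>v n \<Longrightarrow> B *\<^sub>v y = 0\<^sub>v r"
  shows "B * (X * M) = B"
proof (rule mat_eqI_mult_vec)
  have Xc: "X \<in> carrier_mat m n" and MXM: "M * X * M = M" using M X by (auto simp: is_pinv_def)
  show "B * (X * M) \<in> carrier_mat r m" using B Xc M by auto
  show "B \<in> carrier_mat r m" by fact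
  fix x :: "real vec" assume x: "x \<in> carrier_vec m"
  define y where "y = x - (X * M) *\<^sub>v x"
  have XMx: "(X * M) *\<^sub>v x \<in> carrier_vec m" using Xc M x by auto
  then have y: "y \<in> carrier_vec m" using x by (simp add: y_def)
  have "M *\<^sub>v ((X * M) *\<^sub>v x) = (M * X * M) *\<^sub>v x"
    using M Xc x by (simp add: mat_mult_assoc_dim mat_vec_mult_assoc_dim)
  then have "M *\<^sub>v y = 0\<^sub>v n"
    unfolding y_def mult_minus_distrib_mat_vec[OF M x XMx] MXM using M x by auto
  then have "B *\<^sub>v y = 0\<^sub>v r" by (rule ker[OF y])
  then have "B *\<^sub>v x - B *\<^sub>v ((X * M) *\<^sub>v x) = 0\<^sub>v r"
    unfolding y_def mult_minus_distrib_mat_vec[OF B x XMx] .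
  then have "B *\<^sub>v x = B *\<^sub>v ((X * M) *\<^sub>v x)"
    using B x XMx by (intro eq_vecI) (auto simp: vec_eq_iff)
  also have "\<dots> = (B * (X * M)) *\<^sub>v x"
    using assoc_mult_mat_vec[OF B _ x, of "X * M"] Xc M by simp
  finally show "(B * (X * M)) *\<^sub>v x = B *\<^sub>v x" ..
qed

lemma mat_diag_dims: "dim_row (mat_diag n f) = n" "dim_col (mat_diag n f) = n"
  by (simp_all add: mat_diag_def)

text \<open>Invert the nonzero eigenvalues; \<open>inverse 0 = 0\<close> leaves the others at zero.\<close>

lemma is_pinv_symmetric_exists:
  assumes A: "A \<in> carrier_mat n n" "A\<^sup>T = A"
  shows "\<exists>X. is_pinv A X"
proof -
  obtain U d where U: "diagonalizes n U d A" using symmetric_diagonalizable[OF A] by blast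
  have Uc: "U \<in> carrier_mat n n" "U\<^sup>T \<in> carrier_mat n n" and UU: "U\<^sup>T * U = 1\<^sub>m n"
    and Aeq: "A = U * mat_diag n d * U\<^sup>T"
    using U by (auto simp: diagonalizes_def orthonormal_mat_def)
  define S where "S f = U * mat_diag n f * U\<^sup>T" for f
  have Sc: "S f \<in> carrier_mat n n" for f
    unfolding S_def using Uc mat_diag_dim[of n f] by (meson mult_carrier_mat)
  have mult: "S f * S g = S (\<lambda>j. f j * g j)" for f g
  proof -
    have D: "mat_diag n f \<in> carrier_mat n n" "mat_diag n g \<in> carrier_mat n n" by auto
    have "S f * S g = U * (mat_diag n f * ((U\<^sup>T * U) * (mat_diag n g * U\<^sup>T)))"
      unfolding S_def using Uc(1) D
      by (simp add: mat_mult_assoc_dim mat_diag_dims del: assoc_mult_mat mat_diag_diag)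
    also have "(U\<^sup>T * U) * (mat_diag n g * U\<^sup>T) = mat_diag n g * U\<^sup>T"
      unfolding UU using Uc D by (metis left_mult_one_mat mult_carrier_mat)
    also have "U * (mat_diag n f * (mat_diag n g * U\<^sup>T)) = U * (mat_diag n f * mat_diag n g) * U\<^sup>T"
      using Uc(1) D by (simp add: mat_mult_assoc_dim mat_diag_dims del: assoc_mult_mat mat_diag_diag)
    finally show ?thesis by (simp add: S_def)
  qed
  have sym: "(S f)\<^sup>T = S f" for f
  proof -
    have "(mat_diag n f)\<^sup>T = mat_diag n f" by (rule eq_matI) (auto simp: mat_diag_def)
    then show ?thesis
      using symmetric_congruence[OF mat_diag_dim[of n f] Uc(2)] by (simp add: S_def)
  qed
  have inverse_cancel: "a * inverse a * a = a" "inverse a * a * inverse a = inverse a" for a :: real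
    by (cases "a = 0"; simp)+
  have inv: "(\<lambda>j. d j * inverse (d j) * d j) = d" "(\<lambda>j. inverse (d j) * d j * inverse (d j)) = (\<lambda>j. inverse (d j))"
    using inverse_cancel by (auto simp: fun_eq_iff)
  have "is_pinv (S d) (S (\<lambda>j. inverse (d j)))"
    unfolding is_pinv_def mult inv sym by (simp add: carrier_matD[OF Sc] Sc)
  then show ?thesis unfolding Aeq S_def by blast
qed

lemma gram_mat_kernel:
  fixes A :: "real mat"
  assumes A: "A \<in> carrier_mat m n" and y: "y \<in> carrier_vec n" and 0: "(A\<^sup>T * A) *\<^sub>v y = 0\<^sub>v n"
  shows "A *\<^sub>v y = 0\<^sub>v m"
proof -
  have Ay: "A *\<^sub>v y \<in> carrier_vec m" using A y by auto
  have "(A *\<^sub>v y) \<bullet> (A *\<^sub>v y) = (A\<^sup>T *\<^sub>v (A *\<^sub>v y)) \<bullet> y"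
    using transpose_vec_mult_scalar[OF A y Ay] by simp
  also have "A\<^sup>T *\<^sub>v (A *\<^sub>v y) = (A\<^sup>T * A) *\<^sub>v y"
    using A y by (subst assoc_mult_mat_vec[of _ n m _ n]) auto
  finally show ?thesis using scalar_prod_self_eq_0_iff[OF Ay] y 0 by simp
qed

text \<open>The general case reduces to the Gram matrix by \<open>(A\<^sup>T A)\<^sup>\<dagger> A\<^sup>T\<close>, because
  \<open>A\<close> and \<open>A\<^sup>T A\<close> have the same kernel.\<close>

lemma is_pinv_exists: "\<exists>X. is_pinv A X"
proof -
  define m n where "m = dim_row A" and "n = dim_col A"
  have A: "A \<in> carrier_mat m n" by (auto simp: m_def n_def)
  define S where "S = A\<^sup>T * A"
  have S: "S \<in> carrier_mat n n" "S\<^sup>T = S"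
    using A by (auto simp: S_def transpose_mult[of _ n m _ n])
  obtain Y where Y: "is_pinv S Y" using is_pinv_symmetric_exists[OF S] by blast
  have Yc: "Y \<in> carrier_mat n n" using Y S by (auto simp: is_pinv_def)
  have Yt: "Y\<^sup>T = Y" using is_pinv_unique[OF is_pinv_transpose[OF Y, unfolded S(2)] Y] .
  have AYS: "A * (Y * S) = A"
    by (rule mat_mult_is_pinv_absorb[OF S(1) Y A]) (simp add: S_def gram_mat_kernel[OF A])
  define X where "X = Y * A\<^sup>T"
  have Xc: "X \<in> carrier_mat n m" using Yc A by (simp add: X_def)
  have XA: "X * A = Y * S"
    unfolding X_def S_def using Yc A by (simp add: mat_mult_assoc_dim)
  have "A * X * A = A" using AYS XA A Xc by simp
  moreover have "X * A * X = X"
  proof -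
    have "X * A * X = (Y * S * Y) * A\<^sup>T"
      unfolding XA unfolding X_def using S(1) Yc A by (subst (2) assoc_mult_mat[of _ n n _ n _ m]) auto
    then show ?thesis using Y by (simp add: is_pinv_def X_def)
  qed
  moreover have "(A * X)\<^sup>T = A * X"
  proof -
    have "A * X = (A\<^sup>T)\<^sup>T * Y * A\<^sup>T"
      unfolding X_def using Yc A by (simp add: mat_mult_assoc_dim)
    then show ?thesis using symmetric_congruence[OF Yc _ Yt, of "A\<^sup>T" m] A by simp
  qed
  moreover have "(X * A)\<^sup>T = X * A" unfolding XA using Y by (simp add: is_pinv_def)
  ultimately have "is_pinv A X" using Xc by (simp add: is_pinv_def m_def n_def)
  then show ?thesis by blast
qed

lemma is_pinv_pinv: "is_pinv A (pinv A)"
  unfolding pinv_def using is_pinv_exists[of A] is_pinv_unique[of A] by (metis theI)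

text \<open>Among the columns there are \<open>k\<close> independent ones, so the columns span the whole space and each
  unit vector is an image.\<close>

lemma full_row_rank_right_inverse:
  fixes A :: "real mat"
  assumes A: "A \<in> carrier_mat k l" and rank: "vec_space.rank k A = k"
  obtains R where "R \<in> carrier_mat l k" "A * R = 1\<^sub>m k"
proof -
  interpret vec_space "TYPE(real)" k .
  obtain S where S: "finite S" "maximal S (\<lambda>T. T \<subseteq> set (cols A) \<and> lin_indpt T)"
    using maximal_exists_superset[of "set (cols A)" "\<lambda>T. T \<subseteq> set (cols A) \<and> lin_indpt T" "{}"]
      lin_dep_def by auto
  then have SA: "S \<subseteq> set (cols A)" "lin_indpt S" by (auto simp: maximal_def)
  have colsA: "set (cols A) \<subseteq> carrier_vec k" using A cols_dim by blast
  have "card S = k" using rank_card_indpt[OF A S(2)] rank by simp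
  then have "basis S"
    using S(1) SA colsA by (intro dim_li_is_basis) (auto simp: dim_is_n)
  then have "span S = carrier_vec k" by (simp add: basis_def)
  then have "carrier_vec k \<subseteq> col_space A"
    unfolding col_space_def using span_is_monotone[OF SA(1)] by simp
  then have "\<forall>j. \<exists>x\<in>carrier_vec l. A *\<^sub>v x = unit_vec k j"
    unfolding col_space_eq[OF A] using A unit_vec_carrier[of k] by (auto simp: subset_iff)
  then obtain r where r: "\<And>j. r j \<in> carrier_vec l" "\<And>j. A *\<^sub>v r j = unit_vec k j"
    by metis
  define R where "R = mat l k (\<lambda>(i,j). r j $ i)"
  have R: "R \<in> carrier_mat l k" by (simp add: R_def)
  have col: "col R j = r j" if "j < k" for j
    using r(1)[of j] that by (intro eq_vecI) (auto simp: R_def)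
  have "A * R = 1\<^sub>m k"
  proof (rule eq_matI)
    fix i j assume "i < dim_row (1\<^sub>m k)" "j < dim_col (1\<^sub>m k)"
    then have ij: "i < k" "j < k" by auto
    have "(A * R) $$ (i,j) = (A *\<^sub>v r j) $ i" using ij A R col by simp
    then show "(A * R) $$ (i,j) = 1\<^sub>m k $$ (i,j)" using ij r(2) by simp
  qed (use A R in auto)
  with R show ?thesis by (rule that)
qed

lemma full_row_rank_pinv_right_inverse:
  assumes A: "A \<in> carrier_mat k l" and rank: "vec_space.rank k A = k"
  shows "A * pinv A = 1\<^sub>m k" "pinv A \<in> carrier_mat l k"
proof -
  obtain R where R: "R \<in> carrier_mat l k" "A * R = 1\<^sub>m k"
    using full_row_rank_right_inverse[OF A rank] .
  show Xc: "pinv A \<in> carrier_mat l k" using is_pinv_pinv[of A] A by (simp add: is_pinv_def)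
  have "A * pinv A = (A * pinv A) * (A * R)" using R A Xc by simp
  also have "\<dots> = (A * pinv A * A) * R" using R(1) A Xc by (simp add: mat_mult_assoc_dim)
  also have "\<dots> = 1\<^sub>m k" using is_pinv_pinv[of A] R by (simp add: is_pinv_def)
  finally show "A * pinv A = 1\<^sub>m k" .
qed

section \<open>Spectral norm and inverse eigenvalues\<close>

text \<open>The supremum in \<^const>\<open>spectral_norm\<close> dominates its members only if they are bounded. The
  sum of the absolute eigenvalues of \<open>B\<^sup>T B\<close> is a crude bound for their squares.\<close>

lemma spectral_norm_bound:
  assumes B: "B \<in> carrier_mat m n" and x: "x \<in> carrier_vec n"
  shows "(B *\<^sub>v x) \<bullet> (B *\<^sub>v x) \<le> (spectral_norm B)\<^sup>2 * (x \<bullet> x)"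
proof -
  let ?S = "{x \<in> carrier_vec (dim_col B). vec_norm2 x \<le> 1}"
  have S: "B\<^sup>T * B \<in> carrier_mat n n" "(B\<^sup>T * B)\<^sup>T = B\<^sup>T * B"
    using B by (auto simp: transpose_mult_dim)
  obtain U d where U: "diagonalizes n U d (B\<^sup>T * B)" using symmetric_diagonalizable[OF S] by blast
  note Uc = diagonalizes_carrier[OF U]
  define C where "C = (\<Sum>j<n. \<bar>d j\<bar>)"
  have C0: "0 \<le> C" by (simp add: C_def sum_nonneg)
  have gram: "(B *\<^sub>v y) \<bullet> (B *\<^sub>v y) \<le> C * (y \<bullet> y)" if y: "y \<in> carrier_vec n" for y
  proof -
    have By: "B *\<^sub>v y \<in> carrier_vec m" using B y by auto
    have "(B *\<^sub>v y) \<bullet> (B *\<^sub>v y) = y \<bullet> (B\<^sup>T *\<^sub>v (B *\<^sub>v y))"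
      using transpose_vec_mult_scalar[OF B y By] comm_scalar_prod[of "B\<^sup>T *\<^sub>v (B *\<^sub>v y)" n y] B y by simp
    also have "\<dots> = y \<bullet> ((B\<^sup>T * B) *\<^sub>v y)" using B y by (simp add: mat_vec_mult_assoc_dim)
    also have "\<dots> = (\<Sum>j<n. d j * ((U\<^sup>T *\<^sub>v y) $ j)\<^sup>2)" by (rule diagonalizes_quadratic_form[OF U y])
    also have "\<dots> \<le> (\<Sum>j<n. \<bar>d j\<bar> * (y \<bullet> y))"
    proof (rule sum_mono)
      fix j assume j: "j \<in> {..<n}"
      have "((U\<^sup>T *\<^sub>v y) $ j)\<^sup>2 \<le> y \<bullet> y"
        unfolding orthonormal_mat_parseval[OF Uc(3) y] using j by (intro member_le_sum) auto
      then show "d j * ((U\<^sup>T *\<^sub>v y) $ j)\<^sup>2 \<le> \<bar>d j\<bar> * (y \<bullet> y)"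
        by (intro mult_mono) auto
    qed
    finally show ?thesis by (simp add: C_def sum_distrib_right)
  qed
  have "vec_norm2 (B *\<^sub>v y) \<le> sqrt C" if "y \<in> ?S" for y
  proof -
    have y: "y \<in> carrier_vec n" "y \<bullet> y \<le> 1" using that B by (auto simp: vec_norm2_def)
    have "(B *\<^sub>v y) \<bullet> (B *\<^sub>v y) \<le> C * 1"
      using gram[OF y(1)] mult_left_mono[OF y(2) C0] by linarith
    then show ?thesis by (simp add: vec_norm2_def)
  qed
  then have bdd: "bdd_above ((\<lambda>x. vec_norm2 (B *\<^sub>v x)) ` ?S)" by (auto intro!: bdd_aboveI)
  show ?thesis
  proof (cases "x = 0\<^sub>v n")
    case True
    then show ?thesis using gram[OF x] by simp
  next
    case False
    have pos: "0 < x \<bullet> x" by (rule scalar_prod_self_pos[OF x False])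
    define y where "y = (1 / sqrt (x \<bullet> x)) \<cdot>\<^sub>v x"
    have y: "y \<in> carrier_vec n" "y \<bullet> y = 1" using x pos by (auto simp: y_def)
    then have "y \<in> ?S" using B by (auto simp: vec_norm2_def)
    then have le: "vec_norm2 (B *\<^sub>v y) \<le> spectral_norm B"
      unfolding spectral_norm_def by (rule cSUP_upper[OF _ bdd])
    have "B *\<^sub>v y = (1 / sqrt (x \<bullet> x)) \<cdot>\<^sub>v (B *\<^sub>v x)" unfolding y_def by (rule mult_mat_vec[OF B x])
    then have "(B *\<^sub>v y) \<bullet> (B *\<^sub>v y) = (B *\<^sub>v x) \<bullet> (B *\<^sub>v x) / (x \<bullet> x)"
      using B x pos by (simp add: field_simps)
    moreover have "(vec_norm2 (B *\<^sub>v y))\<^sup>2 \<le> (spectral_norm B)\<^sup>2"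
      using le by (intro power_mono) (auto simp: vec_norm2_def scalar_prod_self_nonneg)
    ultimately have "(B *\<^sub>v x) \<bullet> (B *\<^sub>v x) / (x \<bullet> x) \<le> (spectral_norm B)\<^sup>2"
      by (simp add: vec_norm2_def scalar_prod_self_nonneg)
    then show ?thesis using pos by (simp add: field_simps)
  qed
qed

lemma mat_diag_diagonalizes: "diagonalizes n (1\<^sub>m n) d (mat_diag n d)"
  using left_mult_one_mat[OF mat_diag_dim[of n d]] right_mult_one_mat[OF mat_diag_dim[of n d]]
  by (simp add: diagonalizes_def orthonormal_mat_def)

lemma mat_inverse_mat_diag:
  fixes d :: "nat \<Rightarrow> real"
  assumes "\<And>j. j < k \<Longrightarrow> d j \<noteq> 0"
  shows "mat_inverse (mat_diag k d) = Some (mat_diag k (\<lambda>j. 1 / d j))"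
proof -
  let ?D = "mat_diag k d" and ?E = "mat_diag k (\<lambda>j. 1 / d j)"
  have DE: "?D * ?E = 1\<^sub>m k" "?E * ?D = 1\<^sub>m k"
    unfolding mat_diag_diag using assms by (auto simp: mat_diag_def intro!: eq_matI)
  then have "?D \<in> Units (ring_mat TYPE(real) k ())"
    unfolding Units_def by (auto simp: ring_mat_def intro!: bexI[of _ ?E])
  then obtain B where B: "mat_inverse ?D = Some B"
    using mat_inverse(1)[OF mat_diag_dim[of k d], where b = "()"] by (cases "mat_inverse ?D") auto
  have Bp: "?D * B = 1\<^sub>m k" "B \<in> carrier_mat k k"
    using mat_inverse(2)[OF mat_diag_dim B] by auto
  have "B = (?E * ?D) * B" unfolding DE using Bp(2) by simp
  also have "\<dots> = ?E * (?D * B)" by (rule assoc_mult_mat[OF mat_diag_dim mat_diag_dim Bp(2)])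
  also have "\<dots> = ?E" unfolding Bp(1) by (rule right_mult_one_mat[OF mat_diag_dim])
  finally show ?thesis using B by simp
qed

text \<open>The reciprocals of a non-increasing positive diagonal are non-decreasing, so counting the sorted
  list backwards restores the original position.\<close>

lemma inv_eig_mat_diag:
  assumes pos: "\<And>j. j < k \<Longrightarrow> 0 < d j" and mono: "\<And>i j. i \<le> j \<Longrightarrow> j < k \<Longrightarrow> d j \<le> d i" and m: "m < k"
  shows "inv_eig (mat_diag k d) (Suc m) = 1 / d m"
proof -
  have "mat_inverse (mat_diag k d) = Some (mat_diag k (\<lambda>j. 1 / d j))"
    using pos by (intro mat_inverse_mat_diag) force
  then have "inv_eig (mat_diag k d) (Suc m) = eigs_desc (mat_diag k (\<lambda>j. 1 / d j)) ! (k - Suc m)"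
    by (simp add: inv_eig_def eig_def mat_diag_dims)
  also have "eigs_desc (mat_diag k (\<lambda>j. 1 / d j)) = rev (sort (map (\<lambda>j. 1 / d j) [0..<k]))"
    by (rule diagonalizes_eigs_desc[OF mat_diag_diagonalizes])
  also have "sort (map (\<lambda>j. 1 / d j) [0..<k]) = map (\<lambda>j. 1 / d j) [0..<k]"
    using pos mono by (intro sorted_sort_id) (auto simp: sorted_iff_nth_mono intro!: divide_left_mono mult_pos_pos)
  finally show ?thesis using m by (simp add: rev_nth)
qed

section \<open>Positive semidefinite forms\<close>

lemma diagonalizes_psd_nonneg:
  assumes U: "diagonalizes n U d A" and psd: "sym_psd A" and j: "j < n"
  shows "0 \<le> d j"
proof -
  note Uc = diagonalizes_carrier[OF U]
  define x where "x = col U j"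
  have x: "x \<in> carrier_vec n" using Uc by (intro carrier_vecI) (simp add: x_def)
  have "U\<^sup>T *\<^sub>v x = col (U\<^sup>T * U) j" 
    unfolding x_def by (rule col_mult2[symmetric, of _ n n _ n]) (use Uc j in auto)
  also have "\<dots> = unit_vec n j" using Uc(3) j by (simp add: orthonormal_mat_def)
  finally have Ux: "U\<^sup>T *\<^sub>v x = unit_vec n j" .
  have "0 \<le> x \<bullet> (A *\<^sub>v x)" using psd x Uc by (auto simp: sym_psd_def)
  also have "\<dots> = (\<Sum>i<n. if i = j then d j else 0)"
    unfolding diagonalizes_quadratic_form[OF U x] Ux using j by (intro sum.cong) auto
  finally show ?thesis using j by simp
qed

text \<open>In an eigenbasis the form is a sum of nonnegative terms; if it vanishes, so does each of them.\<close>

lemma psd_kernel: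
  assumes K: "K \<in> carrier_mat n n" "sym_psd K" and x: "x \<in> carrier_vec n" and 0: "x \<bullet> (K *\<^sub>v x) = 0"
  shows "K *\<^sub>v x = 0\<^sub>v n"
proof -
  have "K\<^sup>T = K" using K(2) by (simp add: sym_psd_def)
  then obtain U d where U: "diagonalizes n U d K" using symmetric_diagonalizable[OF K(1)] by blast
  have "\<forall>j\<in>{..<n}. d j * ((U\<^sup>T *\<^sub>v x) $ j)\<^sup>2 = 0"
    using 0 unfolding diagonalizes_quadratic_form[OF U x]
    by (subst (asm) sum_nonneg_eq_0_iff) (auto intro!: mult_nonneg_nonneg diagonalizes_psd_nonneg[OF U K(2)])
  then have "(K *\<^sub>v x) \<bullet> (K *\<^sub>v x) = 0"
    unfolding diagonalizes_norm_image[OF U x] by (intro sum.neutral) auto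
  then show ?thesis using scalar_prod_self_eq_0_iff[of "K *\<^sub>v x" n] K x by auto
qed

text \<open>The form is nonnegative at \<open>u - c v\<close>. With a free weight \<open>c\<close> this serves as a linear
  substitute for the Cauchy--Schwarz inequality.\<close>

lemma psd_complete_square:
  fixes c :: real
  assumes K: "K \<in> carrier_mat n n" "sym_psd K" and u: "u \<in> carrier_vec n" and v: "v \<in> carrier_vec n"
  shows "2 * c * (v \<bullet> (K *\<^sub>v u)) \<le> u \<bullet> (K *\<^sub>v u) + c\<^sup>2 * (v \<bullet> (K *\<^sub>v v))"
proof -
  have Kt: "K\<^sup>T = K" using K(2) by (simp add: sym_psd_def)
  have Kc: "K *\<^sub>v u \<in> carrier_vec n" "K *\<^sub>v v \<in> carrier_vec n" "c \<cdot>\<^sub>v v \<in> carrier_vec n" using K u v by auto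
  have swap: "u \<bullet> (K *\<^sub>v v) = v \<bullet> (K *\<^sub>v u)"
    using transpose_vec_mult_scalar[OF K(1) u v] Kt comm_scalar_prod[OF u Kc(2)] by simp
  have "0 \<le> (u - c \<cdot>\<^sub>v v) \<bullet> (K *\<^sub>v (u - c \<cdot>\<^sub>v v))"
    using K u v by (auto simp: sym_psd_def)
  also have "K *\<^sub>v (u - c \<cdot>\<^sub>v v) = K *\<^sub>v u - c \<cdot>\<^sub>v (K *\<^sub>v v)"
    by (simp add: mult_minus_distrib_mat_vec[OF K(1) u Kc(3)] mult_mat_vec[OF K(1) v])
  also have "(u - c \<cdot>\<^sub>v v) \<bullet> (K *\<^sub>v u - c \<cdot>\<^sub>v (K *\<^sub>v v))
      = u \<bullet> (K *\<^sub>v u) - 2 * c * (v \<bullet> (K *\<^sub>v u)) + c\<^sup>2 * (v \<bullet> (K *\<^sub>v v))"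
    using u v Kc swap
    by (simp add: scalar_prod_minus_distrib[of _ n] minus_scalar_prod_distrib[of _ n] power2_eq_square algebra_simps)
  finally show ?thesis by simp
qed

section \<open>The Nystrom approximation as a projection\<close>

text \<open>The Nystrom approximation is \<open>K\<close> composed with a projection: \<open>K\<^sub>N x = K u\<close>, where \<open>u\<close> is
  the orthogonal projection of \<open>x\<close> onto the range of \<open>\<Omega>\<close> with respect to the semi-inner
  product defined by \<open>K\<close>. The explicit choice is \<open>u = \<Omega> M\<^sup>\<dagger> (K \<Omega>)\<^sup>T x\<close> with
  \<open>M = \<Omega>\<^sup>T K \<Omega>\<close>. The orthogonality relation comes from
  \<open>M M\<^sup>\<dagger> (K \<Omega>)\<^sup>T = (K \<Omega>)\<^sup>T\<close>, which holds because for positive semidefinite \<open>K\<close> the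
  matrices \<open>M\<close> and \<open>K \<Omega>\<close> have the same kernel. Both eigenvalue bounds follow from these relations.\<close>

lemma nystrom_projection:
  assumes K: "K \<in> carrier_mat n n" "sym_psd K" and Om: "Om \<in> carrier_mat n l"
  shows nystrom_carrier: "nystrom K Om \<in> carrier_mat n n"
    and nystrom_symmetric: "(nystrom K Om)\<^sup>T = nystrom K Om"
    and nystrom_projection_ex: "x \<in> carrier_vec n \<Longrightarrow> \<exists>u\<in>carrier_vec n.
      nystrom K Om *\<^sub>v x = K *\<^sub>v u \<and> u \<bullet> (K *\<^sub>v u) = x \<bullet> (K *\<^sub>v u) \<and>
      (\<forall>w\<in>carrier_vec l. (Om *\<^sub>v w) \<bullet> (K *\<^sub>v u) = (Om *\<^sub>v w) \<bullet> (K *\<^sub>v x))"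
proof -
  have Kt: "K\<^sup>T = K" using K(2) by (simp add: sym_psd_def)
  define M where "M = Om\<^sup>T * K * Om"
  define X where "X = pinv M"
  have M: "M \<in> carrier_mat l l" using K Om by (auto simp: M_def)
  have Mt: "M\<^sup>T = M" unfolding M_def by (rule symmetric_congruence[OF K(1) Om Kt])
  have X: "is_pinv M X" by (simp add: X_def is_pinv_pinv)
  have Xc: "X \<in> carrier_mat l l" using X M by (simp add: is_pinv_def)
  have Xt: "X\<^sup>T = X" using is_pinv_transpose[OF X] X is_pinv_unique unfolding Mt by blast
  have KOm: "K * Om \<in> carrier_mat n l" "(K * Om)\<^sup>T \<in> carrier_mat l n" using K Om by auto
  have N: "nystrom K Om = (K * Om) * X * (K * Om)\<^sup>T" by (simp add: nystrom_def X_def M_def)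
  show "nystrom K Om \<in> carrier_mat n n" unfolding N using KOm Xc by (meson mult_carrier_mat)
  show "(nystrom K Om)\<^sup>T = nystrom K Om"
    using symmetric_congruence[OF Xc KOm(2) Xt] by (simp add: N)
  have "(K * Om) * (X * M) = K * Om"
  proof (rule mat_mult_is_pinv_absorb[OF M X KOm(1)])
    fix y :: "real vec" assume y: "y \<in> carrier_vec l" and My: "M *\<^sub>v y = 0\<^sub>v l"
    have Oy: "Om *\<^sub>v y \<in> carrier_vec n" "K *\<^sub>v (Om *\<^sub>v y) \<in> carrier_vec n" using Om K y by auto
    have "(Om *\<^sub>v y) \<bullet> (K *\<^sub>v (Om *\<^sub>v y)) = (Om\<^sup>T *\<^sub>v (K *\<^sub>v (Om *\<^sub>v y))) \<bullet> y"
      using transpose_vec_mult_scalar[OF Om y Oy(2)] comm_scalar_prod[OF Oy] by simp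
    also have "Om\<^sup>T *\<^sub>v (K *\<^sub>v (Om *\<^sub>v y)) = M *\<^sub>v y"
      unfolding M_def using Om K(1) y by (simp add: mat_vec_mult_assoc_dim)
    finally have "(Om *\<^sub>v y) \<bullet> (K *\<^sub>v (Om *\<^sub>v y)) = 0" using My y by simp
    then have "K *\<^sub>v (Om *\<^sub>v y) = 0\<^sub>v n" by (rule psd_kernel[OF K Oy(1)])
    then show "(K * Om) *\<^sub>v y = 0\<^sub>v n" using Om K(1) y by (simp add: mat_vec_mult_assoc_dim)
  qed
  then have "((K * Om) * (X * M))\<^sup>T = (K * Om)\<^sup>T" by simp
  then have absorb: "M * X * (K * Om)\<^sup>T = (K * Om)\<^sup>T"
    using KOm(1) Xc M Xt Mt K Om by (simp add: transpose_mult_dim mat_mult_assoc_dim)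
  fix x :: "real vec" assume x: "x \<in> carrier_vec n"
  define b where "b = (K * Om)\<^sup>T *\<^sub>v x"
  have b: "b \<in> carrier_vec l" using KOm x unfolding b_def by (meson mult_mat_vec_carrier)
  have b_eq: "b = Om\<^sup>T *\<^sub>v (K *\<^sub>v x)"
    unfolding b_def using K(1) Om x by (simp add: transpose_mult_dim Kt mat_vec_mult_assoc_dim)
  define t where "t = X *\<^sub>v b"
  have t: "t \<in> carrier_vec l" using Xc b by (auto simp: t_def)
  define u where "u = Om *\<^sub>v t"
  have u: "u \<in> carrier_vec n" "K *\<^sub>v u \<in> carrier_vec n" using Om t K by (auto simp: u_def)
  have Mtb: "M *\<^sub>v t = b"
  proof -
    have "M *\<^sub>v t = (M * X * (K * Om)\<^sup>T) *\<^sub>v x"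
      unfolding t_def b_def using M Xc KOm(1) K Om x
      by (simp add: mat_vec_mult_assoc_dim del: assoc_mult_mat)
    then show ?thesis unfolding absorb b_def .
  qed
  have Nx: "nystrom K Om *\<^sub>v x = K *\<^sub>v u"
    unfolding N u_def t_def b_def using K(1) Om Xc x
    by (simp add: mat_vec_mult_assoc_dim del: assoc_mult_mat)
  have orth: "(Om *\<^sub>v w) \<bullet> (K *\<^sub>v u) = (Om *\<^sub>v w) \<bullet> (K *\<^sub>v x)" if w: "w \<in> carrier_vec l" for w
  proof -
    have Kx: "K *\<^sub>v x \<in> carrier_vec n" and Ow: "Om *\<^sub>v w \<in> carrier_vec n" using K x Om w by auto
    have "(Om *\<^sub>v w) \<bullet> (K *\<^sub>v u) = (Om\<^sup>T *\<^sub>v (K *\<^sub>v u)) \<bullet> w"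
      using transpose_vec_mult_scalar[OF Om w u(2)] comm_scalar_prod[OF Ow u(2)] by simp
    also have "Om\<^sup>T *\<^sub>v (K *\<^sub>v u) = M *\<^sub>v t"
      unfolding M_def u_def using Om K(1) t by (simp add: mat_vec_mult_assoc_dim)
    also have "\<dots> = Om\<^sup>T *\<^sub>v (K *\<^sub>v x)" using Mtb b_eq by simp
    also have "\<dots> \<bullet> w = (Om *\<^sub>v w) \<bullet> (K *\<^sub>v x)"
      using transpose_vec_mult_scalar[OF Om w Kx] comm_scalar_prod[OF Ow Kx] by simp
    finally show ?thesis .
  qed
  have "u \<bullet> (K *\<^sub>v u) = u \<bullet> (K *\<^sub>v x)" using orth[OF t] by (simp add: u_def)
  also have "\<dots> = (K *\<^sub>v u) \<bullet> x" using transpose_vec_mult_scalar[OF K(1) x u(1)] Kt by simp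
  also have "\<dots> = x \<bullet> (K *\<^sub>v u)" using comm_scalar_prod[OF u(2) x] .
  finally show "\<exists>u\<in>carrier_vec n.
      nystrom K Om *\<^sub>v x = K *\<^sub>v u \<and> u \<bullet> (K *\<^sub>v u) = x \<bullet> (K *\<^sub>v u) \<and>
      (\<forall>w\<in>carrier_vec l. (Om *\<^sub>v w) \<bullet> (K *\<^sub>v u) = (Om *\<^sub>v w) \<bullet> (K *\<^sub>v x))"
    using u(1) Nx orth by blast
qed

text \<open>A projection does not increase the semi-norm: with \<open>u\<close> as in the projection lemma,
  \<open>x \<bullet> K\<^sub>N x = u \<bullet> K u\<close>.\<close>

lemma nystrom_le:
  assumes K: "K \<in> carrier_mat n n" "sym_psd K" and Om: "Om \<in> carrier_mat n l" and x: "x \<in> carrier_vec n"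
  shows "x \<bullet> (nystrom K Om *\<^sub>v x) \<le> x \<bullet> (K *\<^sub>v x)"
proof -
  obtain u where u: "u \<in> carrier_vec n" "nystrom K Om *\<^sub>v x = K *\<^sub>v u" "u \<bullet> (K *\<^sub>v u) = x \<bullet> (K *\<^sub>v u)"
    using nystrom_projection_ex[OF K Om x] by blast
  then show ?thesis using psd_complete_square[OF K u(1) x, of 1] by simp
qed

text \<open>Let \<open>v\<close> be in the range of \<open>\<Omega>\<close> and \<open>z = K v\<close>. The projection \<open>u\<close> of \<open>z\<close> satisfies
  \<open>v \<bullet> K u = v \<bullet> K z = z \<bullet> z\<close>, so nonnegativity of the form at \<open>u - c v\<close> gives
  \<open>2 c (z \<bullet> z) \<le> z \<bullet> K\<^sub>N z + c\<^sup>2 (v \<bullet> K v)\<close>. Thus a lower bound \<open>c\<close> for the quotient of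
  \<open>z \<bullet> z\<close> by \<open>v \<bullet> K v\<close> carries over to the Rayleigh quotient of \<open>K\<^sub>N\<close> at \<open>z\<close>.\<close>

lemma nystrom_rayleigh_lower:
  assumes K: "K \<in> carrier_mat n n" "sym_psd K" and Om: "Om \<in> carrier_mat n l" and w: "w \<in> carrier_vec l"
    and v: "v = Om *\<^sub>v w" and c: "0 \<le> c" "c * (v \<bullet> (K *\<^sub>v v)) \<le> (K *\<^sub>v v) \<bullet> (K *\<^sub>v v)"
  shows "c * ((K *\<^sub>v v) \<bullet> (K *\<^sub>v v)) \<le> (K *\<^sub>v v) \<bullet> (nystrom K Om *\<^sub>v (K *\<^sub>v v))"
proof -
  have Kt: "K\<^sup>T = K" using K(2) by (simp add: sym_psd_def)
  have vc: "v \<in> carrier_vec n" "K *\<^sub>v v \<in> carrier_vec n" using Om w K by (auto simp: v)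
  obtain u where u: "u \<in> carrier_vec n" "nystrom K Om *\<^sub>v (K *\<^sub>v v) = K *\<^sub>v u"
      "u \<bullet> (K *\<^sub>v u) = (K *\<^sub>v v) \<bullet> (K *\<^sub>v u)" "v \<bullet> (K *\<^sub>v u) = v \<bullet> (K *\<^sub>v (K *\<^sub>v v))"
    using nystrom_projection_ex[OF K Om vc(2)] w unfolding v by blast
  have "v \<bullet> (K *\<^sub>v u) = (K *\<^sub>v v) \<bullet> (K *\<^sub>v v)"
    using transpose_vec_mult_scalar[OF K(1) vc(2,1)] u(4) Kt by simp
  then have "2 * c * ((K *\<^sub>v v) \<bullet> (K *\<^sub>v v)) \<le> (K *\<^sub>v v) \<bullet> (K *\<^sub>v u) + c\<^sup>2 * (v \<bullet> (K *\<^sub>v v))"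
    using psd_complete_square[OF K u(1) vc(1), of c] u(3) by simp
  also have "c\<^sup>2 * (v \<bullet> (K *\<^sub>v v)) \<le> c * ((K *\<^sub>v v) \<bullet> (K *\<^sub>v v))"
    using mult_left_mono[OF c(2) c(1)] by (simp add: power2_eq_square algebra_simps)
  finally show ?thesis unfolding u(2) by simp
qed

section \<open>The eigenvalue bounds\<close>

lemma eigendecomp_diagonalizes:
  assumes dec: "eigendecomp n k K Vk Vp" and k: "k \<le> n"
  shows "diagonalizes n (append_cols Vk Vp) (\<lambda>j. eig K (Suc j)) K"
proof -
  have "four_block_mat (Lam_top k K) (0\<^sub>m k (n - k)) (0\<^sub>m (n - k) k) (Lam_perp n k K)
      = mat_diag n (\<lambda>j. eig K (Suc j))"
    using k by (intro eq_matI) (auto simp: Lam_top_def Lam_perp_def mat_diag_def)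
  then show ?thesis using dec by (simp add: eigendecomp_def diagonalizes_def)
qed

lemma append_cols_transpose_mult_vec:
  assumes Vk: "Vk \<in> carrier_mat n k" and Vp: "Vp \<in> carrier_mat n (n - k)" and k: "k \<le> n"
    and v: "v \<in> carrier_vec n" and j: "j < n"
  shows "((append_cols Vk Vp)\<^sup>T *\<^sub>v v) $ j
      = (if j < k then (Vk\<^sup>T *\<^sub>v v) $ j else (Vp\<^sup>T *\<^sub>v v) $ (j - k :: nat) :: real)"
proof -
  have "append_cols Vk Vp \<in> carrier_mat n n"
    using Vk Vp k by (auto simp: append_cols_def)
  moreover have "col (append_cols Vk Vp) j = (if j < k then col Vk j else col Vp (j - k))"
    using Vk Vp k j by (intro eq_vecI) (auto simp: append_cols_def)
  ultimately show ?thesis using Vk Vp k j by auto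
qed

lemma sum_split_at:
  fixes f :: "nat \<Rightarrow> real"
  assumes "k \<le> n"
  shows "(\<Sum>j<n. f j) = (\<Sum>j<k. f j) + (\<Sum>j<n - k. f (k + j))"
proof -
  have "(\<Sum>j<n. f j) = (\<Sum>j<k. f j) + (\<Sum>j\<in>{k..<n}. f j)"
    using assms sum.atLeastLessThan_concat[of 0 k n f] by (simp add: atLeast0LessThan)
  also have "(\<Sum>j\<in>{k..<n}. f j) = (\<Sum>j<n - k. f (k + j))"
    using assms sum.shift_bounds_nat_ivl[of f 0 k "n - k"] by (simp add: atLeast0LessThan add.commute)
  finally show ?thesis .
qed

text \<open>The bound in its useful form: with \<open>a\<close> an eigenvalue, \<open>a / (1 + s / a) = a\<^sup>2 / (a + s)\<close>, and
  \<open>b\<^sup>2 / (b + s)\<close> is non-decreasing in \<open>b\<close>.\<close>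

lemma rational_bound_mono:
  fixes a b s :: real
  assumes "0 < a" "a \<le> b" "0 \<le> s"
  shows "a / (1 + 1 / a * s) * (b + s) \<le> b\<^sup>2"
proof -
  have "a\<^sup>2 * b \<le> b\<^sup>2 * a" using assms by (simp add: power2_eq_square mult_mono)
  moreover have "a\<^sup>2 * s \<le> b\<^sup>2 * s" using assms by (intro mult_right_mono power_mono) auto
  ultimately have "a\<^sup>2 * (b + s) \<le> b\<^sup>2 * (a + s)" by (simp add: algebra_simps)
  then have "a\<^sup>2 / (a + s) * (b + s) \<le> b\<^sup>2" using assms by (simp add: pos_divide_le_eq)
  moreover have "a / (1 + 1 / a * s) = a\<^sup>2 / (a + s)"
    using assms by (simp add: field_simps power2_eq_square)
  ultimately show ?thesis by simp
qed

text \<open>The test space for the Courant--Fischer principle consists of the vectors \<open>K \<Omega> \<Omega>\<^sub>k\<^sup>\<dagger> a\<close>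
  with \<open>a\<close> supported on the first \<open>m + 1\<close> coordinates. In the eigenbasis, \<open>v = \<Omega> \<Omega>\<^sub>k\<^sup>\<dagger> a\<close>
  has the leading part \<open>a\<close>, because \<open>\<Omega>\<^sub>k \<Omega>\<^sub>k\<^sup>\<dagger> = 1\<close>, and its trailing part
  contributes at most \<open>s (a \<bullet> a)\<close> to \<open>v \<bullet> K v\<close>. Hence \<open>v \<bullet> K v\<close> is at most the sum of
  \<open>(\<lambda>\<^sub>j + s) a\<^sub>j\<^sup>2\<close>, while \<open>K v \<bullet> K v\<close> is at least the sum of \<open>\<lambda>\<^sub>j\<^sup>2 a\<^sub>j\<^sup>2\<close>; the
  two are compared term by term.\<close>

lemma nystrom_eig_lower:
  fixes K Om Vk Vp :: "real mat"
  assumes K: "K \<in> carrier_mat n n" "sym_psd K"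
    and k: "k \<le> n" "m < k" and pos: "0 < eig K k"
    and Om: "Om \<in> carrier_mat n l"
    and dec: "eigendecomp n k K Vk Vp"
    and rank: "vec_space.rank k (Vk\<^sup>T * Om) = k"
  defines "s \<equiv> (spectral_norm (diag_sqrt (Lam_perp n k K) * (Vp\<^sup>T * Om) * pinv (Vk\<^sup>T * Om)))\<^sup>2"
  shows "eig K (Suc m) / (1 + 1 / eig K (Suc m) * s) \<le> eig (nystrom K Om) (Suc m)"
proof -
  have Kt: "K\<^sup>T = K" using K(2) by (simp add: sym_psd_def)
  define lam where "lam j = eig K (Suc j)" for j
  define V where "V = append_cols Vk Vp"
  define X where "X = pinv (Vk\<^sup>T * Om)"
  define E where "E = inclusion_mat k (Suc m)"
  define W where "W = X * E"
  define c where "c = lam m / (1 + 1 / lam m * s)"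
  have V: "diagonalizes n V lam K"
    using eigendecomp_diagonalizes[OF dec k(1)] by (simp add: V_def lam_def[abs_def])
  have Vk: "Vk \<in> carrier_mat n k" and Vp: "Vp \<in> carrier_mat n (n - k)"
    using dec by (auto simp: eigendecomp_def)
  have VkOm: "Vk\<^sup>T * Om \<in> carrier_mat k l" using Vk Om by auto
  have X: "(Vk\<^sup>T * Om) * X = 1\<^sub>m k" "X \<in> carrier_mat l k"
    using full_row_rank_pinv_right_inverse[OF VkOm rank] by (auto simp: X_def)
  have E: "E \<in> carrier_mat k (Suc m)" by (simp add: E_def)
  have W: "W \<in> carrier_mat l (Suc m)" using X E by (simp add: W_def)
  have mono: "lam j \<le> lam i" if "i \<le> j" "j < n" for i j
    unfolding lam_def by (rule eig_antimono[OF K(1) Kt that])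
  have nonneg: "0 \<le> lam j" if "j < n" for j by (rule diagonalizes_psd_nonneg[OF V K(2) that])
  have lam_m: "0 < lam m" using mono[of m "k - 1"] pos k by (fastforce simp: lam_def)
  have s0: "0 \<le> s" by (simp add: s_def)
  have c0: "0 \<le> c" unfolding c_def using lam_m s0 by simp
  define B where "B = diag_sqrt (Lam_perp n k K) * (Vp\<^sup>T * Om) * X"
  have L: "diag_sqrt (Lam_perp n k K) = mat_diag (n - k) (\<lambda>j. sqrt (lam (k + j)))"
    by (auto simp: diag_sqrt_def Lam_perp_def mat_diag_def lam_def intro!: eq_matI)
  have B: "B \<in> carrier_mat (n - k) k"
    unfolding B_def L using X(2) Vp Om by (intro carrier_matI) (simp_all add: mat_diag_dims)
  have "c \<le> eig (nystrom K Om) (Suc m)"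
  proof (rule courant_fischer_lower[OF nystrom_carrier[OF K Om] nystrom_symmetric[OF K Om], of m "K * Om * W"])
    show "m < n" using k by simp
    show "K * Om * W \<in> carrier_mat n (Suc m)" using K(1) Om W by auto
    fix p :: "real vec" assume p: "p \<in> carrier_vec (Suc m)" "p \<noteq> 0\<^sub>v (Suc m)"
    define a where "a = E *\<^sub>v p"
    define w where "w = X *\<^sub>v a"
    define v where "v = Om *\<^sub>v w"
    define q where "q = Vp\<^sup>T *\<^sub>v v"
    have a: "a \<in> carrier_vec k" using E p by (auto simp: a_def)
    have w: "w \<in> carrier_vec l" using X a by (auto simp: w_def)
    have v: "v \<in> carrier_vec n" using Om w by (auto simp: v_def)
    have q: "q \<in> carrier_vec (n - k)" using Vp v by (auto simp: q_def)
    have Zp: "(K * Om * W) *\<^sub>v p = K *\<^sub>v v"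
      unfolding v_def w_def a_def W_def using K(1) Om X(2) E p(1)
      by (simp add: mat_vec_mult_assoc_dim del: assoc_mult_mat)
    have Va: "Vk\<^sup>T *\<^sub>v v = a"
    proof -
      have "Vk\<^sup>T *\<^sub>v v = ((Vk\<^sup>T * Om) * X) *\<^sub>v a"
        unfolding v_def w_def using Vk Om X(2) a by (simp add: mat_vec_mult_assoc_dim del: assoc_mult_mat)
      then show ?thesis unfolding X(1) using a by simp
    qed
    have coord: "(V\<^sup>T *\<^sub>v v) $ j = (if j < k then a $ j else q $ (j - k))" if "j < n" for j
      unfolding V_def append_cols_transpose_mult_vec[OF Vk Vp k(1) v that] Va q_def ..
    have a_index: "a $ j = (if j \<le> m then p $ j else 0)" if "j < k" for j
      unfolding a_def E_def inclusion_mat_mult_vec[OF p(1)] using that by simp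
    have aa: "(\<Sum>j<k. (a $ j)\<^sup>2) = p \<bullet> p"
      unfolding a_def E_def using sum_power2_inclusion[of "Suc m" k p] p(1) k(2) by simp
    have Ba: "B *\<^sub>v a = mat_diag (n - k) (\<lambda>j. sqrt (lam (k + j))) *\<^sub>v q"
      unfolding B_def L q_def v_def w_def using Vp Om X(2) a
      by (simp add: mat_vec_mult_assoc_dim mat_diag_dims del: assoc_mult_mat)
    have tail: "(\<Sum>j<n - k. lam (k + j) * (q $ j)\<^sup>2) = (B *\<^sub>v a) \<bullet> (B *\<^sub>v a)"
    proof -
      have "(B *\<^sub>v a) \<bullet> (B *\<^sub>v a) = (\<Sum>j<n - k. ((B *\<^sub>v a) $ j)\<^sup>2)"
        using B by (simp add: scalar_prod_self_sum)
      also have "\<dots> = (\<Sum>j<n - k. lam (k + j) * (q $ j)\<^sup>2)"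
        unfolding Ba using nonneg
        by (intro sum.cong) (auto simp: mat_diag_mult_vec_index[OF q] power_mult_distrib)
      finally show ?thesis ..
    qed
    also have "\<dots> \<le> s * (\<Sum>j<k. (a $ j)\<^sup>2)"
      using spectral_norm_bound[OF B a] a by (simp add: s_def B_def X_def scalar_prod_self_sum)
    finally have tail_le: "(\<Sum>j<n - k. lam (k + j) * (q $ j)\<^sup>2) \<le> s * (\<Sum>j<k. (a $ j)\<^sup>2)" .
    have "v \<bullet> (K *\<^sub>v v) = (\<Sum>j<k. lam j * (a $ j)\<^sup>2) + (\<Sum>j<n - k. lam (k + j) * (q $ j)\<^sup>2)"
      unfolding diagonalizes_quadratic_form[OF V v] sum_split_at[OF k(1)] using coord k(1) by simp
    also have "\<dots> \<le> (\<Sum>j<k. (lam j + s) * (a $ j)\<^sup>2)"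
      using tail_le by (simp add: sum.distrib sum_distrib_left distrib_right)
    finally have denom: "v \<bullet> (K *\<^sub>v v) \<le> (\<Sum>j<k. (lam j + s) * (a $ j)\<^sup>2)" .
    have "(\<Sum>j<k. (lam j)\<^sup>2 * (a $ j)\<^sup>2) \<le> (\<Sum>j<n. (lam j)\<^sup>2 * ((V\<^sup>T *\<^sub>v v) $ j)\<^sup>2)"
      unfolding sum_split_at[OF k(1), of "\<lambda>j. (lam j)\<^sup>2 * ((V\<^sup>T *\<^sub>v v) $ j)\<^sup>2"]
      using coord k(1) by (simp add: sum_nonneg)
    then have num: "(\<Sum>j<k. (lam j)\<^sup>2 * (a $ j)\<^sup>2) \<le> (K *\<^sub>v v) \<bullet> (K *\<^sub>v v)"
      unfolding diagonalizes_norm_image[OF V v] .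
    have "c * (v \<bullet> (K *\<^sub>v v)) \<le> c * (\<Sum>j<k. (lam j + s) * (a $ j)\<^sup>2)"
      using denom c0 by (rule mult_left_mono)
    also have "\<dots> \<le> (\<Sum>j<k. (lam j)\<^sup>2 * (a $ j)\<^sup>2)"
      unfolding sum_distrib_left
    proof (rule sum_mono)
      fix j assume j: "j \<in> {..<k}"
      show "c * ((lam j + s) * (a $ j)\<^sup>2) \<le> (lam j)\<^sup>2 * (a $ j)\<^sup>2"
      proof (cases "j \<le> m")
        case True
        then have "c * (lam j + s) \<le> (lam j)\<^sup>2"
          unfolding c_def using mono[of j m] lam_m s0 k by (intro rational_bound_mono) auto
        from mult_right_mono[OF this zero_le_power2[of "a $ j"]] show ?thesis by (simp only: mult.assoc)
      qed (use j a_index in auto)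
    qed
    also note num
    finally have cK: "c * (v \<bullet> (K *\<^sub>v v)) \<le> (K *\<^sub>v v) \<bullet> (K *\<^sub>v v)" .
    have "0 < (lam m)\<^sup>2 * (p \<bullet> p)" using lam_m scalar_prod_self_pos[OF p] by simp
    also have "(lam m)\<^sup>2 * (p \<bullet> p) \<le> (\<Sum>j<k. (lam j)\<^sup>2 * (a $ j)\<^sup>2)"
      unfolding aa[symmetric] sum_distrib_left
    proof (rule sum_mono)
      fix j assume j: "j \<in> {..<k}"
      show "(lam m)\<^sup>2 * (a $ j)\<^sup>2 \<le> (lam j)\<^sup>2 * (a $ j)\<^sup>2"
        using j a_index[of j] mono[of j m] lam_m k
        by (cases "j \<le> m") (auto intro!: mult_right_mono power_mono)
    qed
    also note num
    finally have zpos: "0 < (K *\<^sub>v v) \<bullet> (K *\<^sub>v v)" .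
    show "0 < ((K * Om * W) *\<^sub>v p) \<bullet> ((K * Om * W) *\<^sub>v p) \<and>
        c * (((K * Om * W) *\<^sub>v p) \<bullet> ((K * Om * W) *\<^sub>v p))
          \<le> ((K * Om * W) *\<^sub>v p) \<bullet> (nystrom K Om *\<^sub>v ((K * Om * W) *\<^sub>v p))"
      unfolding Zp using zpos nystrom_rayleigh_lower[OF K Om w v_def c0 cK] by simp
  qed
  then show ?thesis by (simp add: c_def lam_def)
qed

theorem theorem2:
  fixes n k l :: nat and K Om Vk Vp Om_k Om_nk :: "real mat"
  assumes K: "K \<in> carrier_mat n n" "sym_psd K"
    and k: "1 \<le> k" "k < n" "eig K k > 0"
    and Om: "Om \<in> carrier_mat n l"
    and decomp: "eigendecomp n k K Vk Vp"
    and Om_k: "Om_k = Vk\<^sup>T * Om"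
    and Om_nk: "Om_nk = Vp\<^sup>T * Om"
    and rank: "vec_space.rank k Om_k = k"
  shows "\<forall>i \<in> {1..k}.
    eig K i \<ge> eig (nystrom K Om) i \<and>
    eig (nystrom K Om) i \<ge>
      eig K i / (1 + inv_eig (Lam_top k K) i *
        (spectral_norm (diag_sqrt (Lam_perp n k K) * Om_nk * pinv Om_k))\<^sup>2)"
proof
  fix i assume "i \<in> {1..k}"
  then obtain m where i: "i = Suc m" and m: "m < k" by (cases i) auto
  have Kt: "K\<^sup>T = K" using K(2) by (simp add: sym_psd_def)
  have mono: "eig K (Suc j) \<le> eig K (Suc i)" if "i \<le> j" "j < n" for i j
    by (rule eig_antimono[OF K(1) Kt that])
  have "0 < eig K (Suc j)" if "j < k" for j
    using mono[of j "k - 1"] k that by fastforce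
  then have inv: "inv_eig (Lam_top k K) (Suc m) = 1 / eig K (Suc m)"
    using inv_eig_mat_diag[of k "\<lambda>j. eig K (Suc j)" m] mono k(2) m by (simp add: Lam_top_def)
  have "eig (nystrom K Om) (Suc m) \<le> eig K (Suc m)"
    using k m by (intro eig_mono[OF nystrom_carrier[OF K Om] nystrom_symmetric[OF K Om] K(1) Kt]
        nystrom_le[OF K Om]) auto
  moreover have "eig K (Suc m) / (1 + 1 / eig K (Suc m) *
        (spectral_norm (diag_sqrt (Lam_perp n k K) * Om_nk * pinv Om_k))\<^sup>2) \<le> eig (nystrom K Om) (Suc m)"
    using nystrom_eig_lower[OF K _ m k(3) Om decomp] k(2) rank unfolding Om_k Om_nk by simp
  ultimately show "eig K i \<ge> eig (nystrom K Om) i \<and>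
    eig (nystrom K Om) i \<ge>
      eig K i / (1 + inv_eig (Lam_top k K) i *
        (spectral_norm (diag_sqrt (Lam_perp n k K) * Om_nk * pinv Om_k))\<^sup>2)"
    unfolding i inv by simp
qed

end
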